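(* Let $n>2$, let $G=\mathrm{UT}(n,\mathbb{F}_q)$, let $\lambda$ be a nondegenerate character of the associative algebra $\mathfrak{g}_+$, and let $\xi=\xi_\lambda$ be the corresponding character of $G_+$. Then the system of elements $$\{P_\xi X_{S,b}P_\xi:\ S\subset\Pi,\ b\in\Lambda'_S\}$$ is a basis of the Hecke algebra $\mathcal{H}(\lambda)$ of the representation $V(\lambda)=\mathrm{ind}(\xi_\lambda,G_+,G)$ (identified as a vector space with $P_\xi\,\mathbb{C}[G]\,P_\xi$).
   Context: Let $\mathbb{F}_q$ be a finite field with $q$ elements (arbitrary characteristic), $n>2$. $\mathfrak{g}$ is the associative algebra of strictly upper triangular $n\times n$ matrices over $\mathbb{F}_q$, $E$ is the identity matrix, and $G=\mathrm{UT}(n,\mathbb{F}_q)=E+\mathfrak{g}$. A root is a pair $(i,j)$ with $1\le i<j\le n$; $R$ is the set of roots, $E_{(i,j)}=E_{ij}$ is the matrix unit, $R_+=\{(i,j)\in R:i+j<n+1\}$, $\mathfrak{g}_+=\mathrm{span}\{E_\alpha:\alpha\in R_+\}$ (a subalgebra of $\mathfrak{g}$), $G_+=E+\mathfrak{g}_+$ (a subgroup of $G$). Let $k=[\frac{n-1}{2}]$, and $\varepsilon=0$ if $n$ is odd, $\varepsilon=1$ if $n$ is even. $\Pi_0=\{(i,i+1):1\le i\le k\}$, $\Pi=\{(i,n-i):1\le i\le k\}$. A character of $\mathfrak{g}_+$ is a linear form $\lambda:\mathfrak{g}_+\to\mathbb{F}_q$ vanishing on $\mathfrak{g}_+^2$;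 it is nondegenerate if $\lambda(E_\gamma)\ne0$ for all $\gamma\in\Pi\setminus\Pi_0$. Fix a nontrivial complex character $x\mapsto e^x$ of the additive group of $\mathbb{F}_q$, and put $\xi_\lambda(E+x)=e^{\lambda(x)}$ for $x\in\mathfrak{g}_+$, a one-dimensional complex character of $G_+$. Put $P_\xi=\sum_{h\in G_+}\xi(h^{-1})h\in\mathbb{C}[G]$. The representation $V(\lambda)=\mathrm{ind}(\xi_\lambda,G_+,G)$ is realized in $\mathbb{C}[G]P_\xi$ by left multiplication, and its Hecke algebra $\mathcal{H}(\lambda)$, the algebra of all $G$-endomorphisms of $V(\lambda)$, is identified with the algebra $P_\xi\mathbb{C}[G]P_\xi$ with reversed multiplication. For $S\subset\Pi$, $\Lambda'_S$ is the set of vectors $b=(b_1,\dots,b_{k+\varepsilon})$ with all $b_i\in\mathbb{F}_q$ and $b_i\neq0$ whenever $(i,n-i)\in S$. The matrix $X_{S,b}=(x_{ij})\in G$ is defined as follows. 1) $x_{ii}=1$; $x_{ij}=0$ for $i>j$ and for all $i<j$ with $i+j<n+1$. 2) Last column: $x_{in}=b_i$ for $1\le i\le k+\varepsilon$; for $1\le i\le k$, $x_{n-i,n}=b_i$ if $(i,n-i)\in S$, and $x_{n-i,n}=0$ if $(i,n-i)\notin S$. 3) Other columns: for each $1\le i\le k$, if $(i,n-i)\in S$, then $x_{i+1,n-i}=\dots=x_{n-i-1,n-i}=0$; if $(i,n-i)\notin S$, then $x_{r,n-i}=x_{i,n}\,x_{r,n}$ for all $i+1\le r\le n-i-1$. 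*)

theory Defs
  imports
    Complex_Main
    "HOL-Library.FuncSet"
    "HOL-Library.Function_Algebras"
    "HOL-Algebra.Group"
    "Jordan_Normal_Form.Matrix"
begin

section \<open>Complex vector spaces of functions\<close>

definition fscale :: "complex \<Rightarrow> ('g \<Rightarrow> complex) \<Rightarrow> 'g \<Rightarrow> complex" where
  "fscale c f = (\<lambda>x. c * f x)"

definition oscale :: "complex \<Rightarrow> ('v \<Rightarrow> 'g \<Rightarrow> complex) \<Rightarrow> 'v \<Rightarrow> 'g \<Rightarrow> complex" where
  "oscale c \<phi> = (\<lambda>v. fscale c (\<phi> v))"

interpretation fun_space: vector_space fscale
  by unfold_locales (simp_all add: fscale_def fun_eq_iff algebra_simps)

interpretation op_space: vector_space oscale
  by unfold_locales (simp_all add: oscale_def fscale_def fun_eq_iff algebra_simps)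

text \<open>
  \<open>F\<close> is a basis of \<open>W\<close> as an indexed family: in particular distinct indices give
  distinct vectors. The first argument is the scalar multiplication.
\<close>

definition basis_family ::
  "(complex \<Rightarrow> 'v \<Rightarrow> 'v) \<Rightarrow> 'i set \<Rightarrow> ('i \<Rightarrow> 'v::ab_group_add) \<Rightarrow> 'v set \<Rightarrow> bool" where
  "basis_family scale I F W \<longleftrightarrow>
     inj_on F I \<and> \<not> module.dependent scale (F ` I) \<and> module.span scale (F ` I) = W"

section \<open>Group algebras and Hecke algebras\<close>

text \<open>
  Elements of the complex group algebra of a finite group \<open>G\<close> are coefficient functions that
  vanish outside the carrier of \<open>G\<close>.
\<close>

definition group_alg :: "('g, 'm) monoid_scheme \<Rightarrow> ('g \<Rightarrow> complex) set" where
  "group_alg G = {f. \<forall>x. x \<notin> carrier G \<longrightarrow> f x = 0}"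

definition conv ::
  "('g, 'm) monoid_scheme \<Rightarrow> ('g \<Rightarrow> complex) \<Rightarrow> ('g \<Rightarrow> complex) \<Rightarrow> 'g \<Rightarrow> complex" where
  "conv G f h = (\<lambda>x. \<Sum>(y, z) \<in> {(y, z). y \<in> carrier G \<and> z \<in> carrier G \<and> y \<otimes>\<^bsub>G\<^esub> z = x}. f y * h z)"

definition group_elt :: "'g \<Rightarrow> 'g \<Rightarrow> complex" where
  "group_elt g = (\<lambda>x. if x = g then 1 else 0)"

definition P_elt :: "('g, 'm) monoid_scheme \<Rightarrow> 'g set \<Rightarrow> ('g \<Rightarrow> complex) \<Rightarrow> 'g \<Rightarrow> complex" where
  "P_elt G H \<xi> = (\<Sum>h\<in>H. fscale (\<xi> (inv\<^bsub>G\<^esub> h)) (group_elt h))"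

text \<open>The space \<open>\<complex>[G] P\<close>, on which \<open>G\<close> acts by left multiplication, realizes the
  representation induced by the character \<open>\<xi>\<close> of the subgroup \<open>H\<close>.\<close>

definition ind_space :: "('g, 'm) monoid_scheme \<Rightarrow> 'g set \<Rightarrow> ('g \<Rightarrow> complex) \<Rightarrow> ('g \<Rightarrow> complex) set" where
  "ind_space G H \<xi> = {conv G f (P_elt G H \<xi>) | f. f \<in> group_alg G}"

text \<open>
  The algebra of \<open>G\<close>-endomorphisms of the induced representation. An endomorphism is
  represented by a function that is \<open>0\<close> outside \<open>ind_space G H \<xi>\<close>, so that equality of
  functions is equality of endomorphisms.
\<close>

definition hecke_algebra ::
  "('g, 'm) monoid_scheme \<Rightarrow> 'g set \<Rightarrow> ('g \<Rightarrow> complex) \<Rightarrow> (('g \<Rightarrow> complex) \<Rightarrow> 'g \<Rightarrow> complex) set" where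
  "hecke_algebra G H \<xi> = {\<phi>.
     (\<forall>v\<in>ind_space G H \<xi>. \<phi> v \<in> ind_space G H \<xi>) \<and>
     (\<forall>v. v \<notin> ind_space G H \<xi> \<longrightarrow> \<phi> v = 0) \<and>
     (\<forall>v\<in>ind_space G H \<xi>. \<forall>w\<in>ind_space G H \<xi>. \<phi> (v + w) = \<phi> v + \<phi> w) \<and>
     (\<forall>c. \<forall>v\<in>ind_space G H \<xi>. \<phi> (fscale c v) = fscale c (\<phi> v)) \<and>
     (\<forall>g\<in>carrier G. \<forall>v\<in>ind_space G H \<xi>. \<phi> (conv G (group_elt g) v) = conv G (group_elt g) (\<phi> v))}"

definition sandwich ::
  "('g, 'm) monoid_scheme \<Rightarrow> 'g set \<Rightarrow> ('g \<Rightarrow> complex) \<Rightarrow> ('g \<Rightarrow> complex) \<Rightarrow> 'g \<Rightarrow> complex" where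
  "sandwich G H \<xi> f = conv G (conv G (P_elt G H \<xi>) f) (P_elt G H \<xi>)"

text \<open>The space \<open>P \<complex>[G] P\<close>.\<close>

definition sandwich_space ::
  "('g, 'm) monoid_scheme \<Rightarrow> 'g set \<Rightarrow> ('g \<Rightarrow> complex) \<Rightarrow> ('g \<Rightarrow> complex) set" where
  "sandwich_space G H \<xi> = sandwich G H \<xi> ` group_alg G"

text \<open>
  The identification of \<open>P \<complex>[G] P\<close> (with reversed multiplication) with the algebra of
  \<open>G\<close>-endomorphisms sends \<open>a\<close> to right multiplication by \<open>a\<close>.
\<close>

definition right_mult ::
  "('g, 'm) monoid_scheme \<Rightarrow> 'g set \<Rightarrow> ('g \<Rightarrow> complex) \<Rightarrow> ('g \<Rightarrow> complex) \<Rightarrow> ('g \<Rightarrow> complex) \<Rightarrow> 'g \<Rightarrow> complex" where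
  "right_mult G H \<xi> a = (\<lambda>v. if v \<in> ind_space G H \<xi> then conv G v a else 0)"

section \<open>The unitriangular group\<close>

text \<open>
  Roots, and all index sets derived from them, use indices \<open>1, \<dots>, n\<close>; entries of the type
  \<open>mat\<close> are indexed from \<open>0\<close>.
\<close>

definition roots :: "nat \<Rightarrow> (nat \<times> nat) set" where
  "roots n = {(i, j). 1 \<le> i \<and> i < j \<and> j \<le> n}"

definition roots_plus :: "nat \<Rightarrow> (nat \<times> nat) set" where
  "roots_plus n = {(i, j) \<in> roots n. i + j < n + 1}"

definition E_mat :: "nat \<Rightarrow> nat \<times> nat \<Rightarrow> 'a::field mat" where
  "E_mat n \<alpha> = mat n n (\<lambda>(i, j). if (i + 1, j + 1) = \<alpha> then 1 else 0)"

text \<open>The span of the matrix units \<open>E_mat n \<alpha>\<close>, \<open>\<alpha> \<in> D\<close>.\<close>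

definition root_span :: "nat \<Rightarrow> (nat \<times> nat) set \<Rightarrow> 'a::field mat set" where
  "root_span n D = {A \<in> carrier_mat n n. \<forall>i<n. \<forall>j<n. (i + 1, j + 1) \<notin> D \<longrightarrow> A $$ (i, j) = 0}"

definition g_alg :: "nat \<Rightarrow> 'a::field mat set" where
  "g_alg n = root_span n (roots n)"

definition g_plus :: "nat \<Rightarrow> 'a::field mat set" where
  "g_plus n = root_span n (roots_plus n)"

definition UT :: "nat \<Rightarrow> 'a::field mat monoid" where
  "UT n = \<lparr>carrier = {1\<^sub>m n + x | x. x \<in> g_alg n}, monoid.mult = (*), one = 1\<^sub>m n\<rparr>"

definition G_plus :: "nat \<Rightarrow> 'a::field mat set" where
  "G_plus n = {1\<^sub>m n + x | x. x \<in> g_plus n}"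

definition kk :: "nat \<Rightarrow> nat" where
  "kk n = (n - 1) div 2"

definition eps :: "nat \<Rightarrow> nat" where
  "eps n = (if odd n then 0 else 1)"

definition Pi_set :: "nat \<Rightarrow> (nat \<times> nat) set" where
  "Pi_set n = {(i, n - i) | i. 1 \<le> i \<and> i \<le> kk n}"

definition Pi0_set :: "nat \<Rightarrow> (nat \<times> nat) set" where
  "Pi0_set n = {(i, i + 1) | i. 1 \<le> i \<and> i \<le> kk n}"

section \<open>Characters\<close>

text \<open>
  Only the values of \<open>lam\<close> on \<open>g_plus n\<close> matter. For a linear form, vanishing on the span of
  all products of two elements is the same as vanishing on these products.
\<close>

definition algebra_character :: "nat \<Rightarrow> ('a::field mat \<Rightarrow> 'a) \<Rightarrow> bool" where
  "algebra_character n lam \<longleftrightarrow>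
     (\<forall>x\<in>g_plus n. \<forall>y\<in>g_plus n. lam (x + y) = lam x + lam y) \<and>
     (\<forall>c. \<forall>x\<in>g_plus n. lam (c \<cdot>\<^sub>m x) = c * lam x) \<and>
     (\<forall>x\<in>g_plus n. \<forall>y\<in>g_plus n. lam (x * y) = 0)"

definition nondegenerate :: "nat \<Rightarrow> ('a::field mat \<Rightarrow> 'a) \<Rightarrow> bool" where
  "nondegenerate n lam \<longleftrightarrow> (\<forall>\<gamma> \<in> Pi_set n - Pi0_set n. lam (E_mat n \<gamma>) \<noteq> 0)"

definition nontrivial_additive_character :: "('a::field \<Rightarrow> complex) \<Rightarrow> bool" where
  "nontrivial_additive_character \<psi> \<longleftrightarrow>
     \<psi> 0 = 1 \<and> (\<forall>x y. \<psi> (x + y) = \<psi> x * \<psi> y) \<and> (\<exists>x. \<psi> x \<noteq> 1)"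

definition xi_char :: "nat \<Rightarrow> ('a::field \<Rightarrow> complex) \<Rightarrow> ('a mat \<Rightarrow> 'a) \<Rightarrow> 'a mat \<Rightarrow> complex" where
  "xi_char n \<psi> lam g = \<psi> (lam (g - 1\<^sub>m n))"

section \<open>The matrices \<open>X\<close>\<close>

definition Lambda_set :: "nat \<Rightarrow> (nat \<times> nat) set \<Rightarrow> (nat \<Rightarrow> 'a::field) set" where
  "Lambda_set n S = {b \<in> {1..kk n + eps n} \<rightarrow>\<^sub>E UNIV. \<forall>i. (i, n - i) \<in> S \<longrightarrow> b i \<noteq> 0}"

text \<open>
  Rows \<open>1, \<dots>, n - 1\<close> of the last column. A row \<open>i > kk n + eps n\<close> is \<open>i = n - m\<close> with
  \<open>1 \<le> m \<le> kk n\<close>, and then \<open>(m, n - m) = (n - i, i)\<close>.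
\<close>

definition X_last :: "nat \<Rightarrow> (nat \<times> nat) set \<Rightarrow> (nat \<Rightarrow> 'a::field) \<Rightarrow> nat \<Rightarrow> 'a" where
  "X_last n S b i =
     (if i \<le> kk n + eps n then b i
      else if (n - i, i) \<in> S then b (n - i) else 0)"

text \<open>
  The last case concerns a column \<open>j = n - m\<close> with \<open>1 \<le> m \<le> kk n\<close> and \<open>m < i < j\<close>;
  here \<open>(m, n - m) = (n - j, j)\<close>.
\<close>

definition X_entry :: "nat \<Rightarrow> (nat \<times> nat) set \<Rightarrow> (nat \<Rightarrow> 'a::field) \<Rightarrow> nat \<Rightarrow> nat \<Rightarrow> 'a" where
  "X_entry n S b i j =
     (if i = j then 1
      else if i > j \<or> i + j < n + 1 then 0
      else if j = n then X_last n S b i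
      else if (n - j, j) \<in> S then 0
      else X_last n S b (n - j) * X_last n S b i)"

definition X_mat :: "nat \<Rightarrow> (nat \<times> nat) set \<Rightarrow> (nat \<Rightarrow> 'a::field) \<Rightarrow> 'a mat" where
  "X_mat n S b = mat n n (\<lambda>(i, j). X_entry n S b (i + 1) (j + 1))"

definition X_index :: "nat \<Rightarrow> ((nat \<times> nat) set \<times> (nat \<Rightarrow> 'a::field)) set" where
  "X_index n = {(S, b). S \<subseteq> Pi_set n \<and> b \<in> Lambda_set n S}"

definition PXP ::
  "nat \<Rightarrow> ('a::field mat \<Rightarrow> complex) \<Rightarrow> (nat \<times> nat) set \<times> (nat \<Rightarrow> 'a) \<Rightarrow> 'a mat \<Rightarrow> complex" where
  "PXP n \<xi> = (\<lambda>(S, b). sandwich (UT n) (G_plus n) \<xi> (group_elt (X_mat n S b)))"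

end

(*
The elements P g P, with g running over representatives of those double cosets H g H (H = G_+) on
whose stabilizers in H x H the character is trivial, form a basis of P C[G] P.

Every double coset contains some y whose entries in R_+ vanish. If the character is trivial on the
stabilizer of y, then pairs 1 + e_m a, 1 + e_m a y in this stabilizer, with row vectors a that kill
the last column v of y, show by induction on m that the column n - m of y is proportional to v in
the rows m + 1, ..., n - m - 1, with a factor t_m such that t_m v_{n-m} = 0. Thus y is determined
by v and t. Left multiplication by H replaces v_m by any other value, unless v vanishes in the rows
m + 1, ..., n - m, so that v_m can be made equal to v_{n-m} or to t_m; in the exceptional case v_m is
itself the parameter b_m. This gives the matrices X_{S,b}.
Comparing first the last columns and then the columns n - m of h X = X' h' shows that X = X' and
that h and h' have the same character.
*)

theory Submission
  imports Defs "Jordan_Normal_Form.Determinant"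
begin

section \<open>Hecke algebras of linear characters\<close>

text \<open>The factors t_m serve as invariants because right multiplication by H rewrites only the
  entries in R_+, while left multiplication applies the same row operations to the columns n - m and
  n. But t_m is visible only through the products t_m v_r. If v vanishes in the rows m + 1, ..., n -
  m - 1, then t_m is lost; if also v_{n-m} = 0, row m of the last column can no longer be moved. So
  for v_{n-m} = 0 exactly one of t_m and v_m is an invariant, and for this reason X_{S,b} writes b_m
  both into row m of the last column and into the factor of column n - m. The induction on m is
  forced by the group: 1 + e_m a y lies in H only if a y vanishes in the columns beyond n - m.
  Column n is excluded by the choice of a, the columns in between by proportionality for smaller m.
  A character is blind to all roots except (m, m + 1) and (m, n - m), and among these the two
  members of the pair differ only at (m, n - m); nondegeneracy makes this difference
  visible.\<close>

lemma sum_fun_apply: "(\<Sum>i\<in>A. F i) x = (\<Sum>i\<in>A. F i x :: complex)"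
  by (induction A rule: infinite_finite_induct) auto

text \<open>The evaluations at the points \<open>p i\<close> are dual to the family up to nonzero
  factors, which gives independence. Subtracting the combination with coefficients
  \<open>f (p i) / F i (p i)\<close> leaves an element of \<open>W\<close> that vanishes at every
  \<open>p i\<close>, so \<open>sep\<close> gives spanning.\<close>

lemma basis_family_of_dual_points:
  fixes F :: "'i \<Rightarrow> 'g \<Rightarrow> complex"
  assumes "finite I"
    and W: "fun_space.subspace W"
    and F: "\<And>i. i \<in> I \<Longrightarrow> F i \<in> W"
    and diag: "\<And>i. i \<in> I \<Longrightarrow> F i (p i) \<noteq> 0"
    and off: "\<And>i j. i \<in> I \<Longrightarrow> j \<in> I \<Longrightarrow> i \<noteq> j \<Longrightarrow> F i (p j) = 0"
    and sep: "\<And>f. f \<in> W \<Longrightarrow> (\<And>i. i \<in> I \<Longrightarrow> f (p i) = 0) \<Longrightarrow> f = 0"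
  shows "basis_family fscale I F W"
proof -
  have comb: "(\<Sum>i\<in>I. fscale (c i) (F i)) (p j) = c j * F j (p j)" if "j \<in> I" for c j
  proof -
    have "(\<Sum>i\<in>I. fscale (c i) (F i)) (p j) = (\<Sum>i\<in>I. c i * F i (p j))"
      by (simp add: sum_fun_apply fscale_def)
    also have "\<dots> = (\<Sum>i\<in>I. if i = j then c j * F j (p j) else 0)"
      using off that by (intro sum.cong) auto
    finally show ?thesis using that \<open>finite I\<close> by simp
  qed
  have inj: "inj_on F I"
    by (rule inj_onI) (metis diag off)
  have "fun_space.independent (F ` I)"
  proof (rule fun_space.independent_if_scalars_zero)
    show "finite (F ` I)" using \<open>finite I\<close> by simp
    fix u w assume 0: "(\<Sum>x\<in>F ` I. fscale (u x) x) = 0" and "w \<in> F ` I"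
    then obtain j where j: "j \<in> I" "w = F j" by auto
    have "(\<Sum>i\<in>I. fscale (u (F i)) (F i)) = 0"
      using 0 inj by (simp add: sum.reindex)
    then have "u (F j) * F j (p j) = 0"
      using comb[OF j(1), of "\<lambda>i. u (F i)"] by simp
    then show "u w = 0" using diag j by simp
  qed
  moreover have "fun_space.span (F ` I) = W"
  proof
    show "fun_space.span (F ` I) \<subseteq> W"
      using F W by (intro fun_space.span_minimal) auto
    show "W \<subseteq> fun_space.span (F ` I)"
    proof
      fix f assume f: "f \<in> W"
      define s where "s = (\<Sum>i\<in>I. fscale (f (p i) / F i (p i)) (F i))"
      have s: "s \<in> fun_space.span (F ` I)" unfolding s_def
        by (intro fun_space.span_sum fun_space.span_scale fun_space.span_base) auto
      have "s \<in> W" unfolding s_def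
        using F W by (intro fun_space.subspace_sum fun_space.subspace_scale) auto
      then have "f - s = 0"
        using f W comb diag
        by (intro sep fun_space.subspace_diff) (auto simp: s_def)
      then show "f \<in> fun_space.span (F ` I)" using s by simp
    qed
  qed
  ultimately show ?thesis using inj by (simp add: basis_family_def)
qed

text \<open>Injectivity can be asked on \<open>W\<close> only: right multiplication by
  \<open>a\<close>, as a function of \<open>a\<close>, kills for instance every function supported
  outside the group.\<close>

lemma basis_family_linear_image:
  assumes T: "Vector_Spaces.linear fscale oscale T"
    and basis: "basis_family fscale I F W"
    and inj: "\<And>f. f \<in> W \<Longrightarrow> T f = 0 \<Longrightarrow> f = 0"
  shows "basis_family oscale I (\<lambda>i. T (F i)) (T ` W)"
proof -
  interpret T: Vector_Spaces.linear fscale oscale T by (fact T)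
  have F: "inj_on F I" "fun_space.independent (F ` I)" "fun_space.span (F ` I) = W"
    using basis by (auto simp: basis_family_def)
  have inj_W: "inj_on T (fun_space.span (F ` I))"
  proof (rule inj_onI)
    fix f g assume fg: "f \<in> fun_space.span (F ` I)" "g \<in> fun_space.span (F ` I)" "T f = T g"
    then have "f - g \<in> W" using F(3) fun_space.span_diff by blast
    then have "f - g = 0" using fg by (intro inj) (auto simp: T.diff)
    then show "f = g" by simp
  qed
  have image: "(\<lambda>i. T (F i)) ` I = T ` F ` I" by (simp add: image_image)
  have "inj_on (\<lambda>i. T (F i)) I"
    using comp_inj_on[OF F(1) inj_on_subset[OF inj_W fun_space.span_superset]]
    by (simp add: comp_def)
  moreover have "op_space.independent (T ` F ` I)"
    using F(2) inj_W by (rule T.independent_inj_on_image)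
  moreover have "op_space.span (T ` F ` I) = T ` W"
    using T.span_image F(3) by blast
  ultimately show ?thesis by (simp add: basis_family_def image)
qed

locale finite_group_character = group G for G (structure) +
  fixes H :: "'a set" and \<xi> :: "'a \<Rightarrow> complex"
  assumes finite_carrier: "finite (carrier G)"
    and subgroup: "subgroup H G"
    and xi_one: "\<xi> \<one> = 1"
    and xi_mult: "\<And>g h. g \<in> H \<Longrightarrow> h \<in> H \<Longrightarrow> \<xi> (g \<otimes> h) = \<xi> g * \<xi> h"
begin

abbreviation "P \<equiv> P_elt G H \<xi>"
abbreviation "N \<equiv> complex_of_nat (card H)"

lemma H_carrier [simp]: "h \<in> H \<Longrightarrow> h \<in> carrier G"
  using subgroup subgroup.mem_carrier by metis

lemma H_closed [simp]:
  "\<one> \<in> H" "h \<in> H \<Longrightarrow> inv h \<in> H" "g \<in> H \<Longrightarrow> h \<in> H \<Longrightarrow> g \<otimes> h \<in> H"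
  using subgroup by (auto intro: subgroup.m_inv_closed subgroup.m_closed subgroup.one_closed)

lemma finite_H [simp]: "finite H"
  using finite_carrier by (rule finite_subset[rotated]) auto

lemma H_nonempty [simp]: "H \<noteq> {}"
  using H_closed(1) by blast

lemma inv_cancel [simp]:
  assumes "x \<in> carrier G" "y \<in> carrier G"
  shows "x \<otimes> (inv x \<otimes> y) = y" "inv x \<otimes> (x \<otimes> y) = y"
  using assms by (simp_all add: m_assoc[symmetric])

lemma xi_inv: "h \<in> H \<Longrightarrow> \<xi> h * \<xi> (inv h) = 1"
  by (metis H_carrier H_closed(2) r_inv xi_mult xi_one)

section \<open>Convolution on a finite group\<close>

lemma conv_eq:
  assumes "x \<in> carrier G"
  shows "conv G f h x = (\<Sum>y\<in>carrier G. f y * h (inv y \<otimes> x))"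
proof -
  have "{(y, z). y \<in> carrier G \<and> z \<in> carrier G \<and> y \<otimes> z = x}
      = (\<lambda>y. (y, inv y \<otimes> x)) ` carrier G"
    using assms by (auto simp: image_iff inv_solve_left m_assoc[symmetric])
  moreover have "inj_on (\<lambda>y. (y, inv y \<otimes> x)) (carrier G)"
    by (auto simp: inj_on_def)
  ultimately show ?thesis by (simp add: conv_def sum.reindex)
qed

lemma conv_eq_right:
  assumes "x \<in> carrier G"
  shows "conv G f h x = (\<Sum>y\<in>carrier G. f (x \<otimes> inv y) * h y)"
proof -
  have "{(z, y). z \<in> carrier G \<and> y \<in> carrier G \<and> z \<otimes> y = x}
      = (\<lambda>y. (x \<otimes> inv y, y)) ` carrier G"
    using assms by (auto simp: image_iff inv_solve_right m_assoc)
  moreover have "inj_on (\<lambda>y. (x \<otimes> inv y, y)) (carrier G)"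
    by (auto simp: inj_on_def)
  ultimately show ?thesis by (simp add: conv_def sum.reindex)
qed

lemma conv_outside: "x \<notin> carrier G \<Longrightarrow> conv G f h x = 0"
  unfolding conv_def by (rule sum.neutral) auto

lemma conv_in_group_alg [simp]: "conv G f h \<in> group_alg G"
  by (simp add: group_alg_def conv_outside)

lemma group_alg_eqI:
  assumes "f \<in> group_alg G" "h \<in> group_alg G" "\<And>x. x \<in> carrier G \<Longrightarrow> f x = h x"
  shows "f = h"
proof (rule ext)
  show "f x = h x" for x
    using assms by (cases "x \<in> carrier G") (auto simp: group_alg_def)
qed

lemma conv_assoc: "conv G (conv G f g) h = conv G f (conv G g h)"
proof (rule group_alg_eqI; simp?)
  fix x assume x: "x \<in> carrier G"
  have "conv G (conv G f g) h x
      = (\<Sum>y\<in>carrier G. \<Sum>z\<in>carrier G. f z * g (inv z \<otimes> y) * h (inv y \<otimes> x))"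
    using x by (simp add: conv_eq sum_distrib_right)
  also have "\<dots> = (\<Sum>z\<in>carrier G. \<Sum>y\<in>carrier G. f z * g (inv z \<otimes> y) * h (inv y \<otimes> x))"
    by (rule sum.swap)
  also have "\<dots> = (\<Sum>z\<in>carrier G. \<Sum>w\<in>carrier G. f z * g w * h (inv w \<otimes> (inv z \<otimes> x)))"
  proof (rule sum.cong[OF refl])
    fix z assume z: "z \<in> carrier G"
    show "(\<Sum>y\<in>carrier G. f z * g (inv z \<otimes> y) * h (inv y \<otimes> x))
        = (\<Sum>w\<in>carrier G. f z * g w * h (inv w \<otimes> (inv z \<otimes> x)))"
      by (rule sum.reindex_bij_witness[of _ "\<lambda>w. z \<otimes> w" "\<lambda>y. inv z \<otimes> y"])
        (use x z in \<open>auto simp: m_assoc inv_mult_group\<close>)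
  qed
  also have "\<dots> = conv G f (conv G g h) x"
    using x by (simp add: conv_eq sum_distrib_left mult.assoc)
  finally show "conv G (conv G f g) h x = conv G f (conv G g h) x" .
qed

lemma conv_add_left: "conv G (f + f') h = conv G f h + conv G f' h"
  by (auto simp: conv_def fun_eq_iff sum.distrib[symmetric] algebra_simps intro!: sum.cong)

lemma conv_add_right: "conv G f (h + h') = conv G f h + conv G f h'"
  by (auto simp: conv_def fun_eq_iff sum.distrib[symmetric] algebra_simps intro!: sum.cong)

lemma conv_fscale_left: "conv G (fscale c f) h = fscale c (conv G f h)"
  by (auto simp: conv_def fscale_def fun_eq_iff sum_distrib_left algebra_simps intro!: sum.cong)

lemma conv_fscale_right: "conv G f (fscale c h) = fscale c (conv G f h)"
  by (auto simp: conv_def fscale_def fun_eq_iff sum_distrib_left algebra_simps intro!: sum.cong)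

lemma fscale_in_group_alg [simp]: "f \<in> group_alg G \<Longrightarrow> fscale c f \<in> group_alg G"
  by (simp add: group_alg_def fscale_def)

lemma group_elt_in_group_alg [simp]: "g \<in> carrier G \<Longrightarrow> group_elt g \<in> group_alg G"
  by (auto simp: group_alg_def group_elt_def)

lemma conv_group_elt:
  assumes "g \<in> carrier G" "x \<in> carrier G"
  shows "conv G (group_elt g) f x = f (inv g \<otimes> x)"
proof -
  have "conv G (group_elt g) f x = (\<Sum>y\<in>carrier G. if y = g then f (inv g \<otimes> x) else 0)"
    using assms by (auto simp: conv_eq group_elt_def intro!: sum.cong)
  then show ?thesis using assms finite_carrier by simp
qed

lemma conv_one_left: "f \<in> group_alg G \<Longrightarrow> conv G (group_elt \<one>) f = f"
  by (rule group_alg_eqI) (auto simp: conv_group_elt)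

text \<open>A combination of translations: this form turns G-equivariance of a linear map into
  compatibility with the whole group algebra.\<close>

lemma conv_expand_left:
  "conv G f h = (\<Sum>g\<in>carrier G. fscale (f g) (conv G (group_elt g) h))" (is "_ = ?s")
proof (rule group_alg_eqI)
  show "?s \<in> group_alg G"
    by (simp add: group_alg_def sum_fun_apply fscale_def conv_outside)
  fix x assume "x \<in> carrier G"
  then show "conv G f h x = ?s x"
    by (simp add: conv_eq[of x f] sum_fun_apply fscale_def conv_group_elt)
qed simp

section \<open>The element P and the functions in P C[G] P\<close>

lemma P_apply: "P x = (if x \<in> H then \<xi> (inv x) else 0)"
proof -
  have "P x = (\<Sum>h\<in>H. if h = x then \<xi> (inv x) else 0)"
    unfolding P_elt_def sum_fun_apply fscale_def group_elt_def by (rule sum.cong) auto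
  then show ?thesis by simp
qed

lemma P_in_group_alg [simp]: "P \<in> group_alg G"
  by (auto simp: group_alg_def P_apply)

lemma conv_P_left:
  assumes "x \<in> carrier G"
  shows "conv G P f x = (\<Sum>h\<in>H. \<xi> h * f (h \<otimes> x))"
proof -
  have "conv G P f x = (\<Sum>y\<in>H. \<xi> (inv y) * f (inv y \<otimes> x))"
    unfolding conv_eq[OF assms]
    by (rule sum.mono_neutral_cong_right) (auto simp: finite_carrier P_apply)
  also have "\<dots> = (\<Sum>h\<in>H. \<xi> h * f (h \<otimes> x))"
    by (rule sum.reindex_bij_witness[of _ "\<lambda>h. inv h" "\<lambda>h. inv h"]) auto
  finally show ?thesis .
qed

lemma conv_P_right:
  assumes "x \<in> carrier G"
  shows "conv G f P x = (\<Sum>h\<in>H. \<xi> h * f (x \<otimes> h))"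
proof -
  have "conv G f P x = (\<Sum>y\<in>H. f (x \<otimes> inv y) * \<xi> (inv y))"
    unfolding conv_eq_right[OF assms]
    by (rule sum.mono_neutral_cong_right) (auto simp: finite_carrier P_apply)
  also have "\<dots> = (\<Sum>h\<in>H. \<xi> h * f (x \<otimes> h))"
    by (rule sum.reindex_bij_witness[of _ "\<lambda>h. inv h" "\<lambda>h. inv h"]) auto
  finally show ?thesis .
qed

text \<open>Each of the \<open>N\<close> terms of the convolution equals \<open>P x\<close>, so
  \<open>P\<close> is \<open>N\<close> times an idempotent. This is the source of the factors
  \<open>N\<close> and \<open>inverse N\<close> in the identification with endomorphisms.\<close>

lemma P_P: "conv G P P = fscale N P"
proof (rule group_alg_eqI; simp?)
  fix x assume x: "x \<in> carrier G"
  have "\<xi> h * P (h \<otimes> x) = P x" if h: "h \<in> H" for h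
  proof (cases "x \<in> H")
    case True
    then show ?thesis using h xi_inv[OF h]
      by (simp add: P_apply inv_mult_group xi_mult)
  next
    case False
    have "x = inv h \<otimes> (h \<otimes> x)" using h x by (simp add: m_assoc[symmetric])
    then have "h \<otimes> x \<notin> H" using False h H_closed(2,3) by metis
    then show ?thesis using False by (simp add: P_apply)
  qed
  then show "conv G P P x = fscale N P x"
    using x by (simp add: conv_P_left fscale_def)
qed

lemma sandwich_apply:
  assumes "x \<in> carrier G"
  shows "sandwich G H \<xi> f x = (\<Sum>h\<in>H. \<Sum>h'\<in>H. \<xi> h * \<xi> h' * f (h \<otimes> x \<otimes> h'))"
  unfolding sandwich_def conv_assoc
  using assms by (simp add: conv_P_left conv_P_right sum_distrib_left mult.assoc m_assoc)

lemma sandwich_in_group_alg [simp]: "sandwich G H \<xi> f \<in> group_alg G"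
  by (simp add: sandwich_def)

text \<open>Translation absorbs \<open>g\<close> and \<open>g'\<close> into the two sums over
  \<open>H\<close>. Hence a function in P C[G] P is determined on a double coset by its value at one
  point.\<close>

lemma sandwich_equivariant:
  assumes "g \<in> H" "g' \<in> H" "x \<in> carrier G"
  shows "\<xi> g * \<xi> g' * sandwich G H \<xi> f (g \<otimes> x \<otimes> g') = sandwich G H \<xi> f x"
proof -
  have "\<xi> g * \<xi> g' * sandwich G H \<xi> f (g \<otimes> x \<otimes> g')
      = (\<Sum>h\<in>H. \<Sum>h'\<in>H. \<xi> (h \<otimes> g) * \<xi> (g' \<otimes> h') * f ((h \<otimes> g) \<otimes> x \<otimes> (g' \<otimes> h')))"
    using assms
    by (simp add: sandwich_apply sum_distrib_left xi_mult m_assoc mult_ac)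
  also have "\<dots> = (\<Sum>h\<in>H. \<Sum>h'\<in>H. \<xi> h * \<xi> (g' \<otimes> h') * f (h \<otimes> x \<otimes> (g' \<otimes> h')))"
    by (rule sum.reindex_bij_witness[of _ "\<lambda>h. h \<otimes> inv g" "\<lambda>h. h \<otimes> g"])
      (use assms in \<open>auto simp: m_assoc\<close>)
  also have "\<dots> = (\<Sum>h\<in>H. \<Sum>h'\<in>H. \<xi> h * \<xi> h' * f (h \<otimes> x \<otimes> h'))"
    by (rule sum.cong[OF refl], rule sum.reindex_bij_witness[of _ "\<lambda>h. inv g' \<otimes> h" "\<lambda>h. g' \<otimes> h"])
      (use assms in \<open>auto simp: m_assoc\<close>)
  finally show ?thesis using assms by (simp add: sandwich_apply)
qed

lemma sandwich_space_subspace: "fun_space.subspace (sandwich_space G H \<xi>)"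
proof (rule fun_space.subspaceI)
  have "sandwich G H \<xi> 0 = 0"
    by (rule ext) (auto simp: sandwich_def conv_def)
  then show "0 \<in> sandwich_space G H \<xi>"
    unfolding sandwich_space_def by (intro image_eqI[of _ _ 0]) (auto simp: group_alg_def)
  show "f + h \<in> sandwich_space G H \<xi>"
    if fh: "f \<in> sandwich_space G H \<xi>" "h \<in> sandwich_space G H \<xi>" for f h
  proof -
    obtain f' h' where "f' \<in> group_alg G" "h' \<in> group_alg G"
      "f = sandwich G H \<xi> f'" "h = sandwich G H \<xi> h'"
      using fh by (auto simp: sandwich_space_def)
    then show ?thesis unfolding sandwich_space_def
      by (intro image_eqI[of _ _ "f' + h'"])
        (auto simp: sandwich_def conv_add_left conv_add_right group_alg_def)
  qed
  show "fscale c f \<in> sandwich_space G H \<xi>" if f: "f \<in> sandwich_space G H \<xi>" for c f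
  proof -
    obtain f' where "f' \<in> group_alg G" "f = sandwich G H \<xi> f'"
      using f by (auto simp: sandwich_space_def)
    then show ?thesis unfolding sandwich_space_def
      by (intro image_eqI[of _ _ "fscale c f'"])
        (auto simp: sandwich_def conv_fscale_left conv_fscale_right)
  qed
qed

text \<open>A function in \<open>P \<complex>[G] P\<close> vanishes at \<open>g\<close> as soon as \<open>g\<close> has a stabilizer in
  \<open>H \<times> H\<close> on which the character is not trivial.\<close>

definition admissible :: "'a \<Rightarrow> bool" where
  "admissible g \<longleftrightarrow> (\<forall>h\<in>H. \<forall>h'\<in>H. h \<otimes> g = g \<otimes> h' \<longrightarrow> \<xi> h = \<xi> h')"

lemma xi_conj:
  assumes "g \<in> H" "h \<in> H"
  shows "\<xi> (inv h \<otimes> g \<otimes> h) = \<xi> g"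
proof -
  have "\<xi> (inv h) * \<xi> h = 1" using assms xi_inv[of h] by (simp add: mult.commute)
  then show ?thesis using assms by (simp add: xi_mult)
qed

text \<open>Conjugation by the pair \<open>(h, h')\<close> carries the stabilizer of
  \<open>g'\<close> to that of \<open>g\<close>, and conjugation inside \<open>H\<close> does not
  change the values of \<xi>.\<close>

lemma admissible_double_coset:
  assumes g: "admissible g" "g \<in> carrier G" "g' \<in> carrier G"
    and h: "h \<in> H" "h' \<in> H" "h \<otimes> g = g' \<otimes> h'"
  shows "admissible g'"
  unfolding admissible_def
proof (intro ballI impI)
  fix u u' assume u: "u \<in> H" "u' \<in> H" "u \<otimes> g' = g' \<otimes> u'"
  have "inv h \<otimes> u \<otimes> h \<otimes> g = inv h \<otimes> (u \<otimes> g' \<otimes> h')"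
    using g h u(1,2) by (simp add: m_assoc)
  also have "\<dots> = inv h \<otimes> (h \<otimes> g) \<otimes> inv h' \<otimes> (u' \<otimes> h')"
    unfolding u(3) h(3) using g h u by (simp add: m_assoc)
  also have "\<dots> = g \<otimes> (inv h' \<otimes> u' \<otimes> h')"
    using g h(1,2) u(1,2) by (simp add: m_assoc)
  finally have "\<xi> (inv h \<otimes> u \<otimes> h) = \<xi> (inv h' \<otimes> u' \<otimes> h')"
    using g(1) h u unfolding admissible_def by simp
  then show "\<xi> u = \<xi> u'" using h u by (simp add: xi_conj)
qed

text \<open>The representatives are their own evaluation points. By \<open>separate\<close>, every
  term that contributes at \<open>X i\<close> to the function of \<open>i\<close> has weight 1, so
  the value counts a stabilizer; no term of another index contributes there. Covering the admissible
  elements suffices because all functions in the space vanish at the others.\<close>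

lemma sandwich_basis:
  fixes X :: "'i \<Rightarrow> 'a"
  assumes "finite I"
    and X: "\<And>i. i \<in> I \<Longrightarrow> X i \<in> carrier G"
    and cover: "\<And>g. g \<in> carrier G \<Longrightarrow> admissible g \<Longrightarrow>
      \<exists>i\<in>I. \<exists>h\<in>H. \<exists>h'\<in>H. h \<otimes> g = X i \<otimes> h'"
    and separate: "\<And>i j h h'. i \<in> I \<Longrightarrow> j \<in> I \<Longrightarrow> h \<in> H \<Longrightarrow> h' \<in> H \<Longrightarrow>
      h \<otimes> X i = X j \<otimes> h' \<Longrightarrow> i = j \<and> \<xi> h = \<xi> h'"
  shows "basis_family fscale I (\<lambda>i. sandwich G H \<xi> (group_elt (X i))) (sandwich_space G H \<xi>)"
proof (rule basis_family_of_dual_points[OF assms(1) sandwich_space_subspace, where p = X])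
  have move: "h \<otimes> x = y \<otimes> inv h' \<longleftrightarrow> h \<otimes> x \<otimes> h' = y"
    if "h \<in> H" "h' \<in> H" "x \<in> carrier G" "y \<in> carrier G" for h h' x y
    using that inv_solve_right[of "h \<otimes> x" y h'] by auto
  fix i assume i: "i \<in> I"
  show "sandwich G H \<xi> (group_elt (X i)) \<in> sandwich_space G H \<xi>"
    using X i by (auto simp: sandwich_space_def)
  show "sandwich G H \<xi> (group_elt (X i)) (X i) \<noteq> 0"
  proof -
    define Z where "Z = {p \<in> H \<times> H. fst p \<otimes> X i \<otimes> snd p = X i}"
    have "\<xi> h * \<xi> h' = 1" if "h \<in> H" "h' \<in> H" "h \<otimes> X i \<otimes> h' = X i" for h h'
    proof -
      have "\<xi> h = \<xi> (inv h')"
        using separate[of i i h "inv h'"] that i X by (simp add: move)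
      then show ?thesis using xi_inv that by (simp add: mult.commute)
    qed
    then have "sandwich G H \<xi> (group_elt (X i)) (X i)
        = (\<Sum>h\<in>H. \<Sum>h'\<in>H. if h \<otimes> X i \<otimes> h' = X i then 1 else 0)"
      using X i by (auto simp: sandwich_apply group_elt_def intro!: sum.cong)
    also have "\<dots> = (\<Sum>p\<in>H \<times> H. if fst p \<otimes> X i \<otimes> snd p = X i then 1 else 0)"
      by (simp add: sum.cartesian_product case_prod_beta)
    also have "\<dots> = of_nat (card Z)"
      by (simp add: sum.inter_filter[symmetric] Z_def)
    finally have eq: "sandwich G H \<xi> (group_elt (X i)) (X i) = of_nat (card Z)" .
    have "(\<one>, \<one>) \<in> Z" "finite Z"
      using X i by (simp_all add: Z_def)
    then have "card Z > 0" by (auto simp: card_gt_0_iff)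
    then show ?thesis unfolding eq by simp
  qed
  fix j assume j: "j \<in> I" "i \<noteq> j"
  have "h \<otimes> X j \<otimes> h' \<noteq> X i" if "h \<in> H" "h' \<in> H" for h h'
    using separate[of j i h "inv h'"] that i j X by (auto simp: move)
  then show "sandwich G H \<xi> (group_elt (X i)) (X j) = 0"
    using X j by (auto simp: sandwich_apply group_elt_def intro!: sum.neutral)
next
  fix f assume f: "f \<in> sandwich_space G H \<xi>" and f0: "\<And>i. i \<in> I \<Longrightarrow> f (X i) = 0"
  obtain f' where f': "f = sandwich G H \<xi> f'"
    using f by (auto simp: sandwich_space_def)
  have equi: "f x = \<xi> g * \<xi> (inv g') * f (g \<otimes> x \<otimes> inv g')"
    if "g \<in> H" "g' \<in> H" "x \<in> carrier G" for g g' x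
    using sandwich_equivariant[of g "inv g'" x f'] that f' by simp
  show "f = 0"
  proof (rule group_alg_eqI)
    show "f \<in> group_alg G" using f' by simp
    show "0 \<in> group_alg G" by (simp add: group_alg_def)
    fix g assume g: "g \<in> carrier G"
    show "f g = 0 g"
    proof (cases "admissible g")
      case False
      then obtain h h' where h: "h \<in> H" "h' \<in> H" "h \<otimes> g = g \<otimes> h'" "\<xi> h \<noteq> \<xi> h'"
        by (auto simp: admissible_def)
      then have "h \<otimes> g \<otimes> inv h' = g" using g by (simp add: m_assoc)
      then have "f g = \<xi> h * \<xi> (inv h') * f g"
        using equi[of h h' g] h g by simp
      moreover have "\<xi> h * \<xi> (inv h') \<noteq> 1"
      proof
        assume "\<xi> h * \<xi> (inv h') = 1"
        moreover have "\<xi> h' * \<xi> (inv h') = 1" using h xi_inv by simp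
        ultimately show False using h(4) by (metis mult.assoc mult.commute mult_1)
      qed
      ultimately show ?thesis by simp
    next
      case True
      then obtain i h h' where h: "i \<in> I" "h \<in> H" "h' \<in> H" "h \<otimes> g = X i \<otimes> h'"
        using cover[OF g True] by blast
      then have "h \<otimes> g \<otimes> inv h' = X i" using g X by (simp add: m_assoc)
      then show ?thesis using equi[of h h' g] h g f0 by simp
    qed
  qed
qed

section \<open>Endomorphisms of the induced representation as right multiplications\<close>

lemma right_mult_linear: "Vector_Spaces.linear fscale oscale (right_mult G H \<xi>)"
  by unfold_locales
    (auto simp: fun_eq_iff right_mult_def oscale_def conv_add_right conv_fscale_right)

lemma P_in_ind_space: "P \<in> ind_space G H \<xi>"
  unfolding ind_space_def
  by (rule CollectI, rule exI[of _ "group_elt \<one>"]) (simp add: conv_one_left)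

lemma conv_in_ind_space: "v \<in> ind_space G H \<xi> \<Longrightarrow> conv G f v \<in> ind_space G H \<xi>"
  unfolding ind_space_def by (auto simp: conv_assoc[symmetric])

lemma fscale_in_ind_space: "v \<in> ind_space G H \<xi> \<Longrightarrow> fscale c v \<in> ind_space G H \<xi>"
  unfolding ind_space_def by (auto simp: conv_fscale_left[symmetric])

lemma add_in_ind_space:
  assumes "v \<in> ind_space G H \<xi>" "w \<in> ind_space G H \<xi>"
  shows "v + w \<in> ind_space G H \<xi>"
proof -
  obtain f h where "f \<in> group_alg G" "h \<in> group_alg G" "v = conv G f P" "w = conv G h P"
    using assms by (auto simp: ind_space_def)
  then show ?thesis unfolding ind_space_def
    by (intro CollectI exI[of _ "f + h"]) (auto simp: conv_add_left group_alg_def)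
qed

lemma zero_in_ind_space: "0 \<in> ind_space G H \<xi>"
  using fscale_in_ind_space[OF P_in_ind_space, of 0] by (simp add: fscale_def zero_fun_def)

lemma P_sandwich_space:
  assumes "a \<in> sandwich_space G H \<xi>"
  shows "conv G P a = fscale N a"
  using assms
  by (auto simp: sandwich_space_def sandwich_def conv_assoc[symmetric] P_P conv_fscale_left)

lemma right_mult_in_hecke:
  assumes a: "a \<in> sandwich_space G H \<xi>"
  shows "right_mult G H \<xi> a \<in> hecke_algebra G H \<xi>"
proof -
  obtain f where "a = sandwich G H \<xi> f"
    using a by (auto simp: sandwich_space_def)
  then have conv_a: "conv G v a = conv G (conv G (conv G v P) f) P" for v
    by (simp add: sandwich_def conv_assoc)
  have "conv G v a \<in> ind_space G H \<xi>" for v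
    unfolding conv_a by (intro conv_in_ind_space P_in_ind_space)
  then show ?thesis
    by (auto simp: hecke_algebra_def right_mult_def add_in_ind_space fscale_in_ind_space
        conv_in_ind_space conv_add_left conv_fscale_left conv_assoc)
qed

lemma hecke_commutes_with_conv:
  assumes \<phi>: "\<phi> \<in> hecke_algebra G H \<xi>" and v: "v \<in> ind_space G H \<xi>"
  shows "\<phi> (conv G f v) = conv G f (\<phi> v)"
proof -
  have add: "\<phi> (u + w) = \<phi> u + \<phi> w"
    if "u \<in> ind_space G H \<xi>" "w \<in> ind_space G H \<xi>" for u w
    using \<phi> that by (auto simp: hecke_algebra_def)
  have scale: "\<phi> (fscale c u) = fscale c (\<phi> u)" if "u \<in> ind_space G H \<xi>" for c u
    using \<phi> that by (auto simp: hecke_algebra_def)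
  have zero: "\<phi> 0 = 0"
    using scale[OF v, of 0] by (simp add: fscale_def zero_fun_def)
  \<comment> \<open>Membership and additivity are proved together, because \<open>\<phi>\<close> is
    additive only on the induced space.\<close>
  have sum: "(\<Sum>g\<in>A. F g) \<in> ind_space G H \<xi> \<and> \<phi> (\<Sum>g\<in>A. F g) = (\<Sum>g\<in>A. \<phi> (F g))"
    if "\<And>g. F g \<in> ind_space G H \<xi>" for A :: "'a set" and F
    using that
    by (induction A rule: infinite_finite_induct)
      (auto simp: zero zero_in_ind_space add add_in_ind_space)
  have "\<phi> (conv G f v) = (\<Sum>g\<in>carrier G. \<phi> (fscale (f g) (conv G (group_elt g) v)))"
    unfolding conv_expand_left[of f v]
    by (intro conjunct2[OF sum] fscale_in_ind_space conv_in_ind_space v)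
  also have "\<dots> = (\<Sum>g\<in>carrier G. fscale (f g) (conv G (group_elt g) (\<phi> v)))"
    using \<phi> v by (intro sum.cong) (auto simp: scale conv_in_ind_space hecke_algebra_def)
  finally show ?thesis unfolding conv_expand_left[of f "\<phi> v"] .
qed

text \<open>As \<open>P\<close> generates the space, an endomorphism is determined by
  \<open>\<phi> P\<close>; since P P is \<open>N\<close> times \<open>P\<close>, the multiplier has
  to be \<open>\<phi> P\<close> divided by \<open>N\<close>. It lies in P C[G] P because
  \<open>N\<close> times \<open>\<phi> P\<close> is the value of \<open>\<phi>\<close> at P P, that
  is \<open>P\<close> times \<open>\<phi> P\<close>, and \<open>\<phi> P\<close> already ends in
  \<open>P\<close>.\<close>

lemma hecke_is_right_mult:
  assumes \<phi>: "\<phi> \<in> hecke_algebra G H \<xi>"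
  shows "\<phi> \<in> right_mult G H \<xi> ` sandwich_space G H \<xi>"
proof -
  define a where "a = fscale (inverse N) (\<phi> P)"
  have NN: "fscale N (fscale (inverse N) f) = f" "fscale (inverse N) (fscale N f) = f" for f :: "'a \<Rightarrow> complex"
    by (auto simp: fscale_def fun_eq_iff)
  have "\<phi> P \<in> ind_space G H \<xi>"
    using \<phi> P_in_ind_space by (auto simp: hecke_algebra_def)
  then obtain f where f: "f \<in> group_alg G" "\<phi> P = conv G f P"
    by (auto simp: ind_space_def)
  have "\<phi> (fscale N P) = fscale N (\<phi> P)"
    using \<phi> P_in_ind_space by (auto simp: hecke_algebra_def)
  then have P_phi: "conv G P (\<phi> P) = fscale N (\<phi> P)"
    using hecke_commutes_with_conv[OF \<phi> P_in_ind_space, of P] by (simp add: P_P)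
  then have Pa: "conv G P a = \<phi> P" by (simp add: a_def conv_fscale_right NN)
  have "\<phi> P = fscale (inverse N) (sandwich G H \<xi> f)"
    using P_phi f by (metis NN(2) sandwich_def conv_assoc)
  then have "a \<in> sandwich_space G H \<xi>" unfolding a_def
    using sandwich_space_subspace f
    by (simp add: sandwich_space_def fun_space.subspace_scale)
  moreover have "\<phi> v = right_mult G H \<xi> a v" for v
  proof (cases "v \<in> ind_space G H \<xi>")
    case True
    then obtain h where h: "v = conv G h P" by (auto simp: ind_space_def)
    have "\<phi> v = conv G h (\<phi> P)"
      unfolding h by (rule hecke_commutes_with_conv[OF \<phi> P_in_ind_space])
    then show ?thesis using True by (simp add: right_mult_def h conv_assoc Pa)
  next
    case False
    then show ?thesis using \<phi> by (auto simp: right_mult_def hecke_algebra_def)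
  qed
  ultimately show ?thesis by blast
qed

text \<open>Right multiplication by \<open>f\<close>, evaluated at \<open>P\<close>, gives
  \<open>N\<close> times \<open>f\<close>; this is the injectivity that transports the
  basis.\<close>

lemma hecke_basis:
  assumes "basis_family fscale I F (sandwich_space G H \<xi>)"
  shows "basis_family oscale I (\<lambda>i. right_mult G H \<xi> (F i)) (hecke_algebra G H \<xi>)"
proof -
  have "f = 0" if f: "f \<in> sandwich_space G H \<xi>" "right_mult G H \<xi> f = 0" for f
  proof -
    have "right_mult G H \<xi> f P = 0" using f(2) by simp
    then have "fscale N f = 0"
      using P_in_ind_space f(1) by (simp add: right_mult_def P_sandwich_space)
    then show ?thesis by (auto simp: fscale_def fun_eq_iff)
  qed
  moreover have "hecke_algebra G H \<xi> = right_mult G H \<xi> ` sandwich_space G H \<xi>"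
    using right_mult_in_hecke hecke_is_right_mult by blast
  ultimately show ?thesis
    using basis_family_linear_image[OF right_mult_linear assms] by simp
qed

end

section \<open>Entries of unitriangular matrices\<close>

text \<open>One-based access, so that conditions such as \<open>i + j \<le> n\<close> and the column
  \<open>n - m\<close> read as they do for roots. Index 0 would read the same entry as index 1,
  hence the ranges \<open>{1..n}\<close> everywhere.\<close>

definition ent :: "'a mat \<Rightarrow> nat \<Rightarrow> nat \<Rightarrow> 'a" where
  "ent A i j = A $$ (i - 1, j - 1)"

lemma eq_mat_entI:
  assumes "A \<in> carrier_mat n n" "B \<in> carrier_mat n n"
    and "\<And>i j. i \<in> {1..n} \<Longrightarrow> j \<in> {1..n} \<Longrightarrow> ent A i j = ent B i j"
  shows "A = B"
proof (rule eq_matI)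
  show "A $$ (i, j) = B $$ (i, j)" if "i < dim_row B" "j < dim_col B" for i j
    using assms(3)[of "Suc i" "Suc j"] that assms(1,2) by (auto simp: ent_def)
qed (use assms in auto)

lemma ent_mat [simp]:
  "i \<in> {1..n} \<Longrightarrow> j \<in> {1..n} \<Longrightarrow> ent (mat n n (\<lambda>(i, j). f (i + 1) (j + 1))) i j = f i j"
  by (auto simp: ent_def)

lemma ent_one [simp]: "i \<in> {1..n} \<Longrightarrow> j \<in> {1..n} \<Longrightarrow> ent (1\<^sub>m n) i j = (if i = j then 1 else 0)"
  by (auto simp: ent_def)

lemma ent_add:
  "A \<in> carrier_mat n n \<Longrightarrow> B \<in> carrier_mat n n \<Longrightarrow> i \<in> {1..n} \<Longrightarrow> j \<in> {1..n} \<Longrightarrow>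
    ent (A + B) i j = ent A i j + ent B i j"
  by (auto simp: ent_def)

lemma ent_minus:
  "A \<in> carrier_mat n n \<Longrightarrow> B \<in> carrier_mat n n \<Longrightarrow> i \<in> {1..n} \<Longrightarrow> j \<in> {1..n} \<Longrightarrow>
    ent (A - B) i j = ent A i j - ent B i j"
  by (auto simp: ent_def)

lemma ent_smult:
  "A \<in> carrier_mat n n \<Longrightarrow> i \<in> {1..n} \<Longrightarrow> j \<in> {1..n} \<Longrightarrow> ent (c \<cdot>\<^sub>m A) i j = c * ent A i j"
  by (auto simp: ent_def)

lemma ent_E_mat [simp]:
  "i \<in> {1..n} \<Longrightarrow> j \<in> {1..n} \<Longrightarrow> ent (E_mat n \<alpha>) i j = (if (i, j) = \<alpha> then 1 else 0)"
  by (auto simp: ent_def E_mat_def)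

lemma ent_mult:
  fixes A B :: "'a::semiring_0 mat"
  assumes "A \<in> carrier_mat n n" "B \<in> carrier_mat n n" "i \<in> {1..n}" "j \<in> {1..n}"
  shows "ent (A * B) i j = (\<Sum>r\<in>{1..n}. ent A i r * ent B r j)"
proof -
  have "ent (A * B) i j = (\<Sum>r\<in>{0..<n}. A $$ (i - 1, r) * B $$ (r, j - 1))"
    using assms by (auto simp: ent_def scalar_prod_def intro!: sum.cong)
  also have "\<dots> = (\<Sum>r\<in>{1..n}. ent A i r * ent B r j)"
    by (rule sum.reindex_bij_witness[of _ "\<lambda>r. r - 1" Suc]) (auto simp: ent_def)
  finally show ?thesis .
qed

lemma finite_mat: "finite (carrier_mat n n :: 'a::finite mat set)"
proof (rule finite_imageD)
  let ?f = "\<lambda>A :: 'a mat. \<lambda>p\<in>{..<n} \<times> {..<n}. A $$ p"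
  have "?f ` carrier_mat n n \<subseteq> ({..<n} \<times> {..<n}) \<rightarrow>\<^sub>E UNIV"
    by (rule image_subsetI) (simp add: restrict_PiE_iff)
  then show "finite (?f ` carrier_mat n n)"
    by (rule finite_subset) (auto intro: finite_PiE)
  show "inj_on ?f (carrier_mat n n)"
  proof (rule inj_onI)
    fix A B :: "'a mat" assume AB: "A \<in> carrier_mat n n" "B \<in> carrier_mat n n" "?f A = ?f B"
    have "A $$ (i, j) = B $$ (i, j)" if "i < n" "j < n" for i j
      using fun_cong[OF AB(3), of "(i, j)"] that by simp
    then show "A = B" using AB by (intro eq_matI) auto
  qed
qed

lemma root_span_ent:
  assumes "D \<subseteq> roots n"
  shows "A \<in> root_span n D \<longleftrightarrow> A \<in> carrier_mat n n \<and>
    (\<forall>i\<in>{1..n}. \<forall>j\<in>{1..n}. (i, j) \<notin> D \<longrightarrow> ent A i j = 0)"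
proof -
  have "(\<forall>i<n. \<forall>j<n. (i + 1, j + 1) \<notin> D \<longrightarrow> A $$ (i, j) = 0) \<longleftrightarrow>
    (\<forall>i\<in>{1..n}. \<forall>j\<in>{1..n}. (i, j) \<notin> D \<longrightarrow> ent A i j = 0)" (is "?L \<longleftrightarrow> ?R")
  proof
    assume L: ?L
    have "ent A i j = 0" if "i \<in> {1..n}" "j \<in> {1..n}" "(i, j) \<notin> D" for i j
      using L[rule_format, of "i - 1" "j - 1"] that by (auto simp: ent_def)
    then show ?R by blast
  next
    assume R: ?R
    have "A $$ (i, j) = 0" if "i < n" "j < n" "(i + 1, j + 1) \<notin> D" for i j
      using R[rule_format, of "i + 1" "j + 1"] that by (auto simp: ent_def)
    then show ?L by blast
  qed
  then show ?thesis by (auto simp: root_span_def)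
qed

lemma g_plus_ent:
  "A \<in> g_plus n \<longleftrightarrow> A \<in> carrier_mat n n \<and>
    (\<forall>i\<in>{1..n}. \<forall>j\<in>{1..n}. \<not> (i < j \<and> i + j \<le> n) \<longrightarrow> ent A i j = 0)"
  unfolding g_plus_def
  by (subst root_span_ent) (auto simp: roots_plus_def roots_def)

lemma one_plus_root_span_ent:
  assumes "D \<subseteq> roots n"
  shows "A \<in> {1\<^sub>m n + x | x. x \<in> root_span n D} \<longleftrightarrow> A \<in> carrier_mat n n \<and>
    (\<forall>i\<in>{1..n}. \<forall>j\<in>{1..n}. (i, j) \<notin> D \<longrightarrow> ent A i j = (if i = j then 1 else 0))"
    (is "?L \<longleftrightarrow> ?R")
proof
  assume ?L
  then show ?R by (auto simp: root_span_ent[OF assms] ent_add[of _ n])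
next
  assume R: ?R
  then have "A - 1\<^sub>m n \<in> root_span n D" "A = 1\<^sub>m n + (A - 1\<^sub>m n)"
    by (auto simp: root_span_ent[OF assms] ent_minus[of _ n])
  then show ?L by blast
qed

lemma UT_ent:
  "A \<in> carrier (UT n) \<longleftrightarrow> A \<in> carrier_mat n n \<and>
    (\<forall>i\<in>{1..n}. \<forall>j\<in>{1..n}. j \<le> i \<longrightarrow> ent A i j = (if i = j then 1 else 0))"
proof -
  have "(i, j) \<notin> roots n \<longleftrightarrow> j \<le> i" if "i \<in> {1..n}" "j \<in> {1..n}" for i j
    using that by (auto simp: roots_def)
  then show ?thesis
    using one_plus_root_span_ent[of "roots n" n A] by (simp add: UT_def g_alg_def)
qed

lemma G_plus_ent:
  "A \<in> G_plus n \<longleftrightarrow> A \<in> carrier_mat n n \<and>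
    (\<forall>i\<in>{1..n}. \<forall>j\<in>{1..n}. \<not> (i < j \<and> i + j \<le> n) \<longrightarrow> ent A i j = (if i = j then 1 else 0))"
proof -
  have "(i, j) \<notin> roots_plus n \<longleftrightarrow> \<not> (i < j \<and> i + j \<le> n)"
    if "i \<in> {1..n}" "j \<in> {1..n}" for i j
    using that by (auto simp: roots_plus_def roots_def)
  moreover have "roots_plus n \<subseteq> roots n" by (auto simp: roots_plus_def)
  ultimately show ?thesis
    using one_plus_root_span_ent[of "roots_plus n" n A] by (simp add: G_plus_def g_plus_def)
qed

lemma UT_carrier: "A \<in> carrier (UT n) \<Longrightarrow> A \<in> carrier_mat n n"
  by (simp add: UT_ent)

lemma G_plus_UT: "A \<in> G_plus n \<Longrightarrow> A \<in> carrier (UT n)"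
  by (simp add: UT_ent G_plus_ent)

lemma G_plus_carrier: "A \<in> G_plus n \<Longrightarrow> A \<in> carrier_mat n n"
  by (simp add: G_plus_ent)

lemma UT_mult [simp]: "x \<otimes>\<^bsub>UT n\<^esub> y = x * y"
  and UT_one [simp]: "\<one>\<^bsub>UT n\<^esub> = 1\<^sub>m n"
  by (simp_all add: UT_def)

lemma ent_UT_mult:
  assumes A: "A \<in> carrier (UT n)" and B: "B \<in> carrier_mat n n"
    and ij: "i \<in> {1..n}" "j \<in> {1..n}"
  shows "ent (A * B) i j = ent B i j + (\<Sum>r\<in>{i+1..n}. ent A i r * ent B r j)"
proof -
  have "ent (A * B) i j = (\<Sum>r\<in>{i..n}. ent A i r * ent B r j)"
    using assms by (subst ent_mult[OF UT_carrier[OF A] B ij], intro sum.mono_neutral_right)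
      (auto simp: UT_ent)
  also have "{i..n} = insert i {i+1..n}" using ij by auto
  finally show ?thesis using A ij by (simp add: UT_ent)
qed

text \<open>Off the diagonal, row \<open>i\<close> of \<open>A\<close> lives in the columns
  \<open>i + 1\<close> to \<open>n - i\<close>. So left multiplication adds only these rows to row
  \<open>i\<close>, and it leaves row \<open>i\<close> alone when n \<le> 2 i.\<close>

lemma ent_G_plus_mult:
  assumes A: "A \<in> G_plus n" and B: "B \<in> carrier_mat n n"
    and ij: "i \<in> {1..n}" "j \<in> {1..n}"
  shows "ent (A * B) i j = ent B i j + (\<Sum>r\<in>{i+1..n-i}. ent A i r * ent B r j)"
proof -
  have "(\<Sum>r\<in>{i+1..n}. ent A i r * ent B r j) = (\<Sum>r\<in>{i+1..n-i}. ent A i r * ent B r j)"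
    using A ij by (intro sum.mono_neutral_right) (auto simp: G_plus_ent)
  then show ?thesis using ent_UT_mult[OF G_plus_UT[OF A] B ij] by simp
qed

lemma UT_mult_closed:
  assumes "A \<in> carrier (UT n)" "B \<in> carrier (UT n)"
  shows "A * B \<in> carrier (UT n)"
proof -
  have "ent (A * B) i j = (if i = j then 1 else 0)"
    if "i \<in> {1..n}" "j \<in> {1..n}" "j \<le> i" for i j
  proof -
    have "(\<Sum>r\<in>{i+1..n}. ent A i r * ent B r j) = 0"
      using assms that by (intro sum.neutral) (auto simp: UT_ent)
    then show ?thesis
      using ent_UT_mult[OF assms(1) UT_carrier[OF assms(2)] that(1,2)] assms(2) that
      by (simp add: UT_ent)
  qed
  then show ?thesis using assms by (auto simp: UT_ent[of "A * B"] UT_carrier intro!: mult_carrier_mat[of _ n n])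
qed

lemma G_plus_mult_closed:
  assumes "A \<in> G_plus n" "B \<in> G_plus n"
  shows "A * B \<in> G_plus n"
proof -
  have "ent (A * B) i j = (if i = j then 1 else 0)"
    if "i \<in> {1..n}" "j \<in> {1..n}" "\<not> (i < j \<and> i + j \<le> n)" for i j
  proof -
    have "ent B r j = 0" if "r \<in> {i+1..n-i}" for r
    proof -
      have "r \<in> {1..n}" "r \<noteq> j" "\<not> (r < j \<and> r + j \<le> n)"
        using that \<open>\<not> (i < j \<and> i + j \<le> n)\<close> by auto
      then show ?thesis using assms(2) \<open>j \<in> {1..n}\<close> by (simp add: G_plus_ent)
    qed
    then have "(\<Sum>r\<in>{i+1..n-i}. ent A i r * ent B r j) = 0" by simp
    then show ?thesis
      using ent_G_plus_mult[OF assms(1) G_plus_carrier[OF assms(2)] that(1,2)] assms(2) that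
      by (simp add: G_plus_ent)
  qed
  then show ?thesis using assms by (auto simp: G_plus_ent[of "A * B"] G_plus_carrier intro!: mult_carrier_mat[of _ n n])
qed

lemma g_plus_mult_closed:
  assumes "A \<in> g_plus n" "B \<in> g_plus n"
  shows "A * B \<in> g_plus n"
proof -
  have AB: "A \<in> carrier_mat n n" "B \<in> carrier_mat n n" using assms by (auto simp: g_plus_ent)
  have "ent (A * B) i j = 0"
    if "i \<in> {1..n}" "j \<in> {1..n}" "\<not> (i < j \<and> i + j \<le> n)" for i j
  proof -
    have "ent A i r * ent B r j = 0" if "r \<in> {1..n}" for r
      using assms that \<open>i \<in> {1..n}\<close> \<open>j \<in> {1..n}\<close> \<open>\<not> (i < j \<and> i + j \<le> n)\<close>
      by (cases "i < r \<and> i + r \<le> n"; cases "r < j \<and> r + j \<le> n") (auto simp: g_plus_ent)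
    then show ?thesis using ent_mult[OF AB that(1,2)] by (simp add: sum.neutral)
  qed
  then show ?thesis using AB by (auto simp: g_plus_ent intro!: mult_carrier_mat[of _ n n])
qed

section \<open>Inverses in the unitriangular group and in G_+\<close>

lemma UT_det:
  assumes A: "A \<in> carrier (UT n)"
  shows "det A = 1"
proof -
  have ent: "A $$ (i, j) = (if i = j then 1 else 0)" if "i < n" "j \<le> i" for i j
  proof -
    have "\<forall>i\<in>{1..n}. \<forall>j\<in>{1..n}. j \<le> i \<longrightarrow> ent A i j = (if i = j then 1 else 0)"
      using A unfolding UT_ent by (rule conjunct2)
    from this[rule_format, of "Suc i" "Suc j"] that show ?thesis by (simp add: ent_def)
  qed
  have "upper_triangular A" using ent UT_carrier[OF A] by (auto simp: upper_triangular_def)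
  then have "det A = prod_list (diag_mat A)" by (rule det_upper_triangular[OF _ UT_carrier[OF A]])
  also have "diag_mat A = map (\<lambda>i. 1) [0..<n]"
    using ent UT_carrier[OF A] by (auto simp: diag_mat_def)
  finally show ?thesis by (simp add: map_replicate_const)
qed

text \<open>Left multiplication by \<open>A\<close> is injective on the finite set \<open>M\<close>,
  hence onto, and so hits the identity matrix. One argument serves both the whole group and
  \<open>G_plus n\<close>.\<close>

lemma inverse_in_closed_set:
  fixes A :: "'a::{field,finite} mat"
  assumes M: "M \<subseteq> carrier (UT n)" "1\<^sub>m n \<in> M"
    and closed: "\<And>A B. A \<in> M \<Longrightarrow> B \<in> M \<Longrightarrow> A * B \<in> M"
    and A: "A \<in> M"
  shows "\<exists>B\<in>M. A * B = 1\<^sub>m n \<and> B * A = 1\<^sub>m n"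
proof -
  have mat: "B \<in> carrier_mat n n" if "B \<in> M" for B using M that UT_carrier by blast
  have "A \<in> Units (ring_mat TYPE('a) n ())"
    using det_non_zero_imp_unit[OF mat[OF A]] UT_det M A by fastforce
  then obtain C where C: "C \<in> carrier_mat n n" "C * A = 1\<^sub>m n"
    by (auto simp: Units_def ring_mat_def)
  have "inj_on (\<lambda>B. A * B) M"
  proof (rule inj_onI)
    fix B B' assume B: "B \<in> M" "B' \<in> M" "A * B = A * B'"
    then have "C * A * B = C * A * B'"
      using C(1) A mat by (simp add: assoc_mult_mat[of _ n n _ n _ n])
    then show "B = B'" using B(1,2) C(2) mat left_mult_one_mat by metis
  qed
  moreover have "finite M" using mat finite_subset[OF _ finite_mat] by blast
  ultimately have "(\<lambda>B. A * B) ` M = M"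
    using closed A by (intro endo_inj_surj) auto
  then obtain B where B: "B \<in> M" "A * B = 1\<^sub>m n" using M(2) by (metis imageE)
  then have "B * A = 1\<^sub>m n" using mat A mat_mult_left_right_inverse by blast
  then show ?thesis using B by blast
qed

lemma one_in_UT [simp]: "1\<^sub>m n \<in> carrier (UT n)"
  and one_in_G_plus [simp]: "1\<^sub>m n \<in> G_plus n"
  by (auto simp: UT_ent G_plus_ent)

lemma UT_group: "group (UT n :: 'a::{field,finite} mat monoid)"
proof (rule groupI)
  show "\<exists>y\<in>carrier (UT n). y \<otimes>\<^bsub>UT n\<^esub> x = \<one>\<^bsub>UT n\<^esub>"
    if "x \<in> carrier (UT n)" for x :: "'a mat"
    using inverse_in_closed_set[of "carrier (UT n)" n x] that UT_mult_closed by auto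
qed (auto simp: UT_mult_closed left_mult_one_mat[OF UT_carrier] UT_carrier assoc_mult_mat[of _ n n _ n _ n])

lemma G_plus_subgroup: "subgroup (G_plus n) (UT n :: 'a::{field,finite} mat monoid)"
proof -
  interpret group "UT n :: 'a mat monoid" by (rule UT_group)
  show ?thesis
  proof (rule subgroupI)
    show "inv\<^bsub>UT n\<^esub> x \<in> G_plus n" if x: "x \<in> G_plus n" for x :: "'a mat"
    proof -
      have "\<exists>y\<in>G_plus n. x * y = 1\<^sub>m n \<and> y * x = 1\<^sub>m n"
        by (rule inverse_in_closed_set) (use x in \<open>auto simp: G_plus_mult_closed G_plus_UT\<close>)
      then obtain y where y: "y \<in> G_plus n" "y * x = 1\<^sub>m n" by auto
      then have "inv\<^bsub>UT n\<^esub> x = y" using inv_equality[of y x] x by (simp add: G_plus_UT)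
      then show ?thesis using y by simp
    qed
    show "G_plus n \<noteq> ({} :: 'a mat set)" using one_in_G_plus by blast
  qed (simp_all add: G_plus_mult_closed G_plus_UT subset_iff)
qed

section \<open>Characters of the algebra\<close>

lemma g_plus_carrier: "x \<in> g_plus n \<Longrightarrow> x \<in> carrier_mat n n"
  by (simp add: g_plus_ent)

lemma g_plus_add_closed: "x \<in> g_plus n \<Longrightarrow> y \<in> g_plus n \<Longrightarrow> x + y \<in> g_plus n"
  by (simp add: g_plus_ent ent_add[of _ n])

lemma g_plus_smult_closed: "x \<in> g_plus n \<Longrightarrow> c \<cdot>\<^sub>m x \<in> g_plus n"
  by (simp add: g_plus_ent ent_smult[of _ n])

lemma G_plus_minus_one: "h \<in> G_plus n \<Longrightarrow> h - 1\<^sub>m n \<in> g_plus n"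
  by (auto simp: g_plus_ent G_plus_ent ent_minus[of _ n])

lemma G_plus_mult_minus_one:
  assumes "g \<in> G_plus n" "h \<in> G_plus n"
  shows "g * h - 1\<^sub>m n
    = (g - 1\<^sub>m n) + (h - 1\<^sub>m n) + (g - 1\<^sub>m n) * (h - 1\<^sub>m n)"
proof -
  obtain x y where xy: "g = 1\<^sub>m n + x" "h = 1\<^sub>m n + y" "x \<in> g_plus n" "y \<in> g_plus n"
    using assms by (auto simp: G_plus_def)
  then have xyc: "x \<in> carrier_mat n n" "y \<in> carrier_mat n n" by (auto simp: g_plus_carrier)
  have "g * h = 1\<^sub>m n + x + (y + x * y)"
    unfolding xy using xyc
    by (simp add: add_mult_distrib_mat[of _ n n _ _ n] mult_add_distrib_mat[of _ n n _ n])
  moreover have "g - 1\<^sub>m n = x" "h - 1\<^sub>m n = y"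
    using xy xyc by (auto intro!: eq_matI)
  moreover have "1\<^sub>m n + x + (y + x * y) - 1\<^sub>m n = x + y + x * y"
    using xyc mult_carrier_mat[OF xyc]
    by (intro eq_matI) (auto simp del: index_mult_mat(1))
  ultimately show ?thesis by simp
qed

text \<open>It suffices to test the kernel vectors v_s e_r - v_r e_s with a fixed pivot
  \<open>v s \<noteq> 0\<close>. It will be applied with \<open>v\<close> the last column and
  \<open>w\<close> the column n - m of y - 1.\<close>

lemma functional_vanishing_on_kernel:
  fixes v w :: "'i \<Rightarrow> 'a::field"
  assumes "finite R"
    and ker: "\<And>a. (\<Sum>r\<in>R. a r * v r) = 0 \<Longrightarrow> (\<Sum>r\<in>R. a r * w r) = 0"
  shows "\<exists>c. \<forall>r\<in>R. w r = c * v r"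
proof (cases "\<exists>s\<in>R. v s \<noteq> 0")
  case False
  have "w r = 0" if "r \<in> R" for r
    using ker[of "\<lambda>s. if s = r then 1 else 0"] False that \<open>finite R\<close>
    by (simp add: if_distrib[of "\<lambda>x. x * _"] cong: if_cong)
  then show ?thesis by (intro exI[of _ 0]) simp
next
  case True
  then obtain s where s: "s \<in> R" "v s \<noteq> 0" by auto
  have "w r = w s / v s * v r" if r: "r \<in> R" for r
  proof -
    have comb: "(\<Sum>i\<in>R. ((if i = r then v s else 0) - (if i = s then v r else 0)) * u i)
        = v s * u r - v r * u s" for u :: "'i \<Rightarrow> 'a"
      using \<open>finite R\<close> r s
      by (simp add: left_diff_distrib sum_subtractf if_distrib[of "\<lambda>x. x * _"] cong: if_cong)
    have "v s * w r - v r * w s = 0"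
      using ker[of "\<lambda>i. (if i = r then v s else 0) - (if i = s then v r else 0)"]
      unfolding comb by simp
    then show ?thesis using s by (simp add: field_simps)
  qed
  then show ?thesis by blast
qed

locale algebra_char =
  fixes n :: nat and lam :: "'a::{field,finite} mat \<Rightarrow> 'a" and \<psi> :: "'a \<Rightarrow> complex"
  assumes n: "n > 2"
    and psi: "nontrivial_additive_character \<psi>"
    and lam: "algebra_character n lam"
    and nondeg: "nondegenerate n lam"
begin

abbreviation "k \<equiv> kk n"

lemma lam_add: "x \<in> g_plus n \<Longrightarrow> y \<in> g_plus n \<Longrightarrow> lam (x + y) = lam x + lam y"
  and lam_smult: "x \<in> g_plus n \<Longrightarrow> lam (c \<cdot>\<^sub>m x) = c * lam x"
  and lam_mult: "x \<in> g_plus n \<Longrightarrow> y \<in> g_plus n \<Longrightarrow> lam (x * y) = 0"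
  using lam by (auto simp: algebra_character_def)

lemma psi_zero: "\<psi> 0 = 1" and psi_add: "\<psi> (x + y) = \<psi> x * \<psi> y"
  using psi by (auto simp: nontrivial_additive_character_def)

lemma psi_nonzero: "\<psi> x \<noteq> 0"
  using psi_add[of x "- x"] psi_zero by auto

lemma n_bounds: "2 * k + 1 \<le> n" "n \<le> 2 * k + 2"
  using n by (auto simp: kk_def)

text \<open>Such an \<open>x\<close> is a single product \<open>u * w\<close> of two elements of the algebra:
  \<open>u\<close> is a sum of matrix units on the superdiagonal, and row \<open>i + 1\<close> of \<open>w\<close> is
  row \<open>i\<close> of \<open>x\<close>.\<close>

lemma lam_eq_zero:
  assumes x: "x \<in> g_plus n"
    and x0: "\<And>m. m \<in> {1..k} \<Longrightarrow> ent x m (m + 1) = 0 \<and> ent x m (n - m) = 0"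
  shows "lam x = 0"
proof -
  \<comment> \<open>The bound \<open>i \<le> k\<close> is exactly the condition that (i, i + 1) lies
    in R_+, because 2k + 1 \<le> n \<le> 2k + 2.\<close>
  define fu where "fu i j = (if j = i + 1 \<and> i \<le> k then 1 else 0 :: 'a)" for i j
  define fw where "fw i j = (if 2 \<le> i \<and> i < j \<and> i + j \<le> n then ent x (i - 1) j else 0)" for i j
  define u where "u = mat n n (\<lambda>(i, j). fu (i + 1) (j + 1))"
  define w where "w = mat n n (\<lambda>(i, j). fw (i + 1) (j + 1))"
  have ent_u: "ent u i j = fu i j" and ent_w: "ent w i j = fw i j"
    if "i \<in> {1..n}" "j \<in> {1..n}" for i j
    unfolding u_def w_def by (rule ent_mat[OF that])+
  have carrier: "u \<in> carrier_mat n n" "w \<in> carrier_mat n n" by (auto simp: u_def w_def)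
  then have g: "u \<in> g_plus n" "w \<in> g_plus n"
    using n_bounds by (auto simp: g_plus_ent ent_u ent_w fu_def fw_def)
  have "ent x i j = ent (u * w) i j" if ij: "i \<in> {1..n}" "j \<in> {1..n}" for i j
  proof -
    have "ent (u * w) i j = (\<Sum>r\<in>{1..n}. if r = i + 1 then (if i \<le> k then fw r j else 0) else 0)"
      unfolding ent_mult[OF carrier ij]
      using ij by (intro sum.cong) (auto simp: ent_u ent_w fu_def)
    also have "\<dots> = (if i \<le> k then fw (i + 1) j else 0)"
      using n_bounds by (auto simp: sum.delta)
    also have "\<dots> = ent x i j"
    proof (cases "i + 1 < j \<and> i + 1 + j \<le> n")
      case True
      then show ?thesis using ij n_bounds by (auto simp: fw_def)
    next
      case False
      have "ent x i j = 0"
      proof (cases "i < j \<and> i + j \<le> n")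
        case ij': True
        then have "i \<in> {1..k}" "j = i + 1 \<or> j = n - i" using False ij n_bounds by auto
        then show ?thesis using x0 by auto
      next
        case False
        then show ?thesis using x ij by (auto simp: g_plus_ent)
      qed
      then show ?thesis using False by (auto simp: fw_def)
    qed
    finally show ?thesis by simp
  qed
  then have "x = u * w"
    using carrier x by (intro eq_mat_entI[of _ n]) (auto simp: g_plus_carrier)
  then show ?thesis using g lam_mult by simp
qed

lemma lam_cong:
  assumes x: "x \<in> g_plus n" and y: "y \<in> g_plus n"
    and xy: "\<And>m. m \<in> {1..k} \<Longrightarrow>
      ent x m (m + 1) = ent y m (m + 1) \<and> ent x m (n - m) = ent y m (n - m)"
  shows "lam x = lam y"
proof -
  have y': "(- 1) \<cdot>\<^sub>m y \<in> g_plus n" using y by (rule g_plus_smult_closed)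
  have "lam (x + (- 1) \<cdot>\<^sub>m y) = 0"
  proof (rule lam_eq_zero)
    fix m assume m: "m \<in> {1..k}"
    have "m \<in> {1..n}" "m + 1 \<in> {1..n}" "n - m \<in> {1..n}" using m n_bounds by auto
    then show "ent (x + (- 1) \<cdot>\<^sub>m y) m (m + 1) = 0 \<and> ent (x + (- 1) \<cdot>\<^sub>m y) m (n - m) = 0"
      using x y y' xy[OF m]
      by (simp add: g_plus_carrier ent_add[of _ n] ent_smult[of _ n])
  qed (intro g_plus_add_closed x y')
  then show ?thesis using x y' y by (simp add: lam_add lam_smult)
qed

text \<open>Multiplicativity comes from g h - 1 = (g - 1) + (h - 1) + (g - 1)(h - 1), whose last
  term \<open>lam\<close> kills.\<close>

sublocale finite_group_character "UT n" "G_plus n" "xi_char n \<psi> lam"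
proof (intro finite_group_character.intro finite_group_character_axioms.intro)
  show "finite (carrier (UT n :: 'a mat monoid))"
    by (rule finite_subset[OF _ finite_mat[of n]]) (auto simp: UT_carrier)
  have "lam (0 \<cdot>\<^sub>m (1\<^sub>m n - 1\<^sub>m n)) = 0 * lam (1\<^sub>m n - 1\<^sub>m n)"
    by (intro lam_smult G_plus_minus_one) simp
  moreover have "0 \<cdot>\<^sub>m (1\<^sub>m n - 1\<^sub>m n) = (1\<^sub>m n - 1\<^sub>m n :: 'a mat)"
    by (intro eq_matI) auto
  ultimately show "xi_char n \<psi> lam \<one>\<^bsub>UT n\<^esub> = 1"
    by (simp add: xi_char_def psi_zero)
  show "xi_char n \<psi> lam (g \<otimes>\<^bsub>UT n\<^esub> h) = xi_char n \<psi> lam g * xi_char n \<psi> lam h"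
    if "g \<in> G_plus n" "h \<in> G_plus n" for g h
    using that
    by (simp add: xi_char_def G_plus_mult_minus_one G_plus_minus_one lam_add lam_mult
        g_plus_add_closed g_plus_mult_closed psi_add)
qed (fact UT_group G_plus_subgroup)+

section \<open>Matrices vanishing above the antidiagonal\<close>

definition G_minus :: "'a mat set" where
  "G_minus = {y \<in> carrier (UT n). \<forall>i\<in>{1..n}. \<forall>j\<in>{1..n}. i < j \<and> i + j \<le> n \<longrightarrow> ent y i j = 0}"

lemma G_minus_UT: "y \<in> G_minus \<Longrightarrow> y \<in> carrier (UT n)"
  by (simp add: G_minus_def)

lemma G_minus_carrier: "y \<in> G_minus \<Longrightarrow> y \<in> carrier_mat n n"
  by (simp add: G_minus_UT UT_carrier)

lemma ent_G_minus:
  assumes "y \<in> G_minus" "i \<in> {1..n}" "j \<in> {1..n}"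
  shows "j < i \<Longrightarrow> ent y i j = 0" "ent y i i = 1" "i < j \<Longrightarrow> i + j \<le> n \<Longrightarrow> ent y i j = 0"
  using assms by (auto simp: G_minus_def UT_ent)

text \<open>An intermediate index r other than i and j would satisfy i < r < j and r + j \<le> n,
  hence i + r \<le> n, where \<open>y\<close> vanishes. So the product shows \<open>h\<close> on R_+
  and \<open>y\<close> elsewhere, and both factors can be read off.\<close>

lemma ent_G_minus_mult:
  assumes y: "y \<in> G_minus" and h: "h \<in> G_plus n" and ij: "i \<in> {1..n}" "j \<in> {1..n}"
  shows "ent (y * h) i j = (if i < j \<and> i + j \<le> n then ent h i j else ent y i j)"
proof -
  let ?c = "\<lambda>r. (if r = j then ent y i j else 0) + (if r = i then (if i < j \<and> i + j \<le> n then ent h i j else 0) else 0)"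
  have "ent y i r * ent h r j = ?c r" if r: "r \<in> {1..n}" for r
  proof (cases "r = j")
    case True
    then show ?thesis using h ij by (auto simp: G_plus_ent)
  next
    case rj: False
    show ?thesis
    proof (cases "r < j \<and> r + j \<le> n")
      case True
      then have "r \<noteq> i \<Longrightarrow> ent y i r = 0"
        using ent_G_minus[OF y ij(1) r] by (cases "r < i") auto
      then show ?thesis using ent_G_minus[OF y ij(1) ij(1)] True rj by auto
    next
      case False
      then have "ent h r j = 0" using h ij r rj by (auto simp: G_plus_ent)
      then show ?thesis using False rj by auto
    qed
  qed
  then have "ent (y * h) i j = (\<Sum>r\<in>{1..n}. ?c r)"
    unfolding ent_mult[OF G_minus_carrier[OF y] G_plus_carrier[OF h] ij] by (rule sum.cong[OF refl])
  also have "\<dots> = ent y i j + (if i < j \<and> i + j \<le> n then ent h i j else 0)"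
    using ij by (simp add: sum.distrib)
  finally show ?thesis using ent_G_minus[OF y ij] by auto
qed

text \<open>By the formula for \<open>y * h\<close>, distributing the entries of \<open>g\<close>
  between R_+ and its complement is already the factorization.\<close>

lemma UT_factorization:
  assumes g: "g \<in> carrier (UT n)"
  shows "\<exists>y\<in>G_minus. \<exists>h\<in>G_plus n. g = y * h"
proof -
  define fy where "fy i j = (if i < j \<and> i + j \<le> n then 0 else ent g i j)" for i j
  define fh where "fh i j = (if i = j then 1 else if i < j \<and> i + j \<le> n then ent g i j else 0)" for i j
  define y where "y = mat n n (\<lambda>(i, j). fy (i + 1) (j + 1))"
  define h where "h = mat n n (\<lambda>(i, j). fh (i + 1) (j + 1))"
  have ent_y: "ent y i j = fy i j" and ent_h: "ent h i j = fh i j"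
    if "i \<in> {1..n}" "j \<in> {1..n}" for i j
    unfolding y_def h_def by (rule ent_mat[OF that])+
  have carrier: "y \<in> carrier_mat n n" "h \<in> carrier_mat n n" by (auto simp: y_def h_def)
  have y: "y \<in> G_minus"
    using g carrier by (auto simp: G_minus_def UT_ent ent_y fy_def)
  have h: "h \<in> G_plus n"
    using carrier by (auto simp: G_plus_ent ent_h fh_def)
  have "g = y * h"
  proof (rule eq_mat_entI[of _ n])
    show "ent g i j = ent (y * h) i j" if "i \<in> {1..n}" "j \<in> {1..n}" for i j
      unfolding ent_G_minus_mult[OF y h that] using that by (auto simp: ent_y ent_h fy_def fh_def)
  qed (use g carrier in \<open>auto intro: UT_carrier\<close>)
  then show ?thesis using y h by blast
qed

text \<open>Both conditions together say that column n - m of y - 1 is t_m times the last column on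
  the rows m + 1, ..., n - m: the entry of y - 1 in row n - m is 0. The factors are an argument
  because they are not determined where the last column vanishes.\<close>

definition proportional :: "(nat \<Rightarrow> 'a) \<Rightarrow> 'a mat \<Rightarrow> bool" where
  "proportional t y \<longleftrightarrow> (\<forall>m\<in>{1..k}. (\<forall>r\<in>{m<..<n-m}. ent y r (n - m) = t m * ent y r n) \<and>
     t m * ent y (n - m) n = 0)"

lemma last_column:
  assumes "y \<in> G_minus" "y' \<in> G_minus" "h \<in> G_plus n" "h' \<in> G_plus n" "h * y = y' * h'"
    and i: "i \<in> {1..n}"
  shows "ent y' i n = ent y i n + (\<Sum>r\<in>{i+1..n-i}. ent h i r * ent y r n)"
proof -
  have "n \<in> {1..n}" using n by simp
  then show ?thesis
    using assms ent_G_minus_mult[of y' h' i n] ent_G_plus_mult[of h n y i n]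
    by (auto simp: G_minus_carrier)
qed

text \<open>The rows r + 1, ..., n - r that \<open>h\<close> adds to row r stay strictly between m
  and n - m, so one factor governs them all, and \<open>h'\<close> does not touch these entries. The
  common multiplier \<open>ent y' r n\<close> cannot be cancelled where it is 0.\<close>

lemma proportional_double_coset:
  assumes y: "y \<in> G_minus" "y' \<in> G_minus" and h: "h \<in> G_plus n" "h' \<in> G_plus n"
    and eq: "h * y = y' * h'"
    and t: "proportional t y" "proportional t' y'"
    and m: "m \<in> {1..k}" and r: "r \<in> {m<..<n-m}"
  shows "t m * ent y' r n = t' m * ent y' r n"
proof -
  have rm: "r \<in> {1..n}" "n - m \<in> {1..n}" using m r by auto
  have "t' m * ent y' r n = ent y' r (n - m)"
    using t(2) m r by (auto simp: proportional_def)
  also have "\<dots> = ent (h * y) r (n - m)"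
    unfolding eq ent_G_minus_mult[OF y(2) h(2) rm] using m r by auto
  also have "\<dots> = ent y r (n - m) + (\<Sum>s\<in>{r+1..n-r}. ent h r s * ent y s (n - m))"
    using y h rm by (intro ent_G_plus_mult G_minus_carrier)
  also have "\<dots> = t m * ent y r n + (\<Sum>s\<in>{r+1..n-r}. ent h r s * (t m * ent y s n))"
    using t(1) m r by (intro arg_cong2[where f = "(+)"] sum.cong) (auto simp: proportional_def)
  also have "\<dots> = t m * ent y' r n"
    unfolding last_column[OF y h eq rm(1)] by (simp add: sum_distrib_left algebra_simps)
  finally show ?thesis by (rule sym)
qed

text \<open>At (m, m + 1) the entries agree, because among the rows added to row m only row m + 1 of
  \<open>y\<close> is nonzero in that column. At (m, n - m) they differ by t_m times what the rows
  strictly between m and n - m contribute to row m of the last column. That row is unchanged, so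
  this contribution cancels the one of row n - m, a multiple of v_{n-m}, which t_m
  annihilates.\<close>

lemma lam_double_coset:
  assumes y: "y \<in> G_minus" "y' \<in> G_minus" and h: "h \<in> G_plus n" "h' \<in> G_plus n"
    and eq: "h * y = y' * h'" and t: "proportional t y"
    and last: "\<And>m. m \<in> {1..k} \<Longrightarrow> ent y' m n = ent y m n"
  shows "lam (h - 1\<^sub>m n) = lam (h' - 1\<^sub>m n)"
proof (rule lam_cong)
  fix m assume m: "m \<in> {1..k}"
  have rng: "m \<in> {1..n}" "m + 1 \<in> {1..n}" "n - m \<in> {1..n}" "Suc m \<le> n - m" "m < n - m"
    using m n_bounds by auto
  have h': "ent h' m j = ent y m j + (\<Sum>s\<in>{m+1..n-m}. ent h m s * ent y s j)"
    if "j \<in> {1..n}" "m < j" "m + j \<le> n" for j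
    using ent_G_minus_mult[OF y(2) h(2) rng(1) that(1)] that
      ent_G_plus_mult[OF h(1) G_minus_carrier[OF y(1)] rng(1) that(1)] eq by simp
  have "(\<Sum>s\<in>{m+1..n-m}. ent h m s * ent y s (m+1)) = (\<Sum>s\<in>{m+1..n-m}. if s = m + 1 then ent h m (m + 1) else 0)"
    using rng ent_G_minus[OF y(1) _ rng(2)] by (intro sum.cong) auto
  then have e1: "ent h' m (m + 1) = ent h m (m + 1)"
    using h'[OF rng(2)] ent_G_minus(3)[OF y(1) rng(1,2)] m n_bounds rng(4) by simp
  have split: "{m+1..n-m} = insert (n - m) {m<..<n-m}" using m n_bounds by auto
  let ?s = "\<Sum>s\<in>{m<..<n-m}. ent h m s * ent y s n"
  have "(\<Sum>s\<in>{m<..<n-m}. ent h m s * ent y s (n-m)) = t m * ?s"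
    unfolding sum_distrib_left using t m by (intro sum.cong) (auto simp: proportional_def)
  then have e2: "ent h' m (n - m) = ent h m (n - m) + t m * ?s"
    using h'[OF rng(3)] ent_G_minus(2)[OF y(1) rng(3) rng(3)] ent_G_minus(3)[OF y(1) rng(1,3)] m n_bounds rng(5)
    unfolding split by simp
  have "ent h m (n - m) * ent y (n - m) n + ?s = 0"
    using last_column[OF y h eq rng(1)] last[OF m] unfolding split by simp
  then have "t m * ?s = - ent h m (n - m) * (t m * ent y (n - m) n)"
    by (simp add: eq_neg_iff_add_eq_0 algebra_simps flip: distrib_left)
  also have "\<dots> = 0" using t m by (simp add: proportional_def)
  finally have "ent h' m (n - m) = ent h m (n - m)" using e2 by simp
  then show "ent (h - 1\<^sub>m n) m (m + 1) = ent (h' - 1\<^sub>m n) m (m + 1) \<and>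
    ent (h - 1\<^sub>m n) m (n - m) = ent (h' - 1\<^sub>m n) m (n - m)"
    using e1 h rng by (simp add: ent_minus[of _ n] G_plus_carrier)
qed (use h in \<open>simp_all add: G_plus_minus_one\<close>)

section \<open>The matrices \<open>X\<close> as double coset representatives\<close>

lemma n_eps: "n = 2 * k + 1 + eps n"
  using n by (auto simp: kk_def eps_def elim: oddE evenE)

lemma ent_X: "i \<in> {1..n} \<Longrightarrow> j \<in> {1..n} \<Longrightarrow> ent (X_mat n S b) i j = X_entry n S b i j"
  unfolding X_mat_def by (rule ent_mat)

lemma X_G_minus: "X_mat n S b \<in> G_minus"
proof -
  have "X_mat n S b \<in> carrier_mat n n" by (simp add: X_mat_def)
  then show ?thesis by (auto simp: G_minus_def UT_ent ent_X X_entry_def)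
qed

lemma X_last_column: "i \<in> {1..<n} \<Longrightarrow> ent (X_mat n S b) i n = X_last n S b i"
  by (subst ent_X) (auto simp: X_entry_def)

lemma X_last_low:
  assumes "m \<in> {1..k}"
  shows "X_last n S b (n - m) = (if (m, n - m) \<in> S then b m else 0)"
  using assms n_eps by (auto simp: X_last_def)

lemma X_proportional: "proportional (\<lambda>m. if (m, n - m) \<in> S then 0 else b m) (X_mat n S b)"
  unfolding proportional_def
proof (intro ballI conjI)
  fix m assume m: "m \<in> {1..k}"
  then have nm: "n - m \<in> {1..<n}" "n - (n - m) = m" "m \<le> k + eps n" using n_bounds by auto
  show "(if (m, n - m) \<in> S then 0 else b m) * ent (X_mat n S b) (n - m) n = 0"
    unfolding X_last_column[OF nm(1)] X_last_low[OF m] by simp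
  fix r assume r: "r \<in> {m<..<n - m}"
  then have "r \<in> {1..n}" "n - m \<in> {1..n}" "r \<in> {1..<n}" using m by auto
  then show "ent (X_mat n S b) r (n - m) = (if (m, n - m) \<in> S then 0 else b m) * ent (X_mat n S b) r n"
    using r m nm by (auto simp: ent_X X_last_column X_entry_def X_last_def)
qed

text \<open>The rows i of the last column with n \<le> 2 i are untouched by H; they carry S, the b_m
  with (m, n - m) in S and, for even n, the middle parameter. Any other b_m is the factor of column
  n - m, or, if that column shows nothing, the entry of a row m that cannot move.\<close>

lemma X_separate:
  assumes I: "(S, b) \<in> X_index n" "(S', b') \<in> X_index n"
    and h: "h \<in> G_plus n" "h' \<in> G_plus n"
    and eq: "h * X_mat n S b = X_mat n S' b' * h'"
  shows "(S, b) = (S', b') \<and> lam (h - 1\<^sub>m n) = lam (h' - 1\<^sub>m n)"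
proof -
  define v where "v = X_last n S b"
  define v' where "v' = X_last n S' b'"
  have S: "S \<subseteq> Pi_set n" "S' \<subseteq> Pi_set n"
    and b: "b \<in> Lambda_set n S" "b' \<in> Lambda_set n S'"
    using I by (auto simp: X_index_def)
  have col: "v' i = v i + (\<Sum>r\<in>{i+1..n-i}. ent h i r * v r)" if i: "i \<in> {1..<n}" for i
  proof -
    have "i \<in> {1..n}" using i by simp
    note last_column[OF X_G_minus X_G_minus h eq this]
    moreover have "(\<Sum>r\<in>{i+1..n-i}. ent h i r * ent (X_mat n S b) r n)
        = (\<Sum>r\<in>{i+1..n-i}. ent h i r * v r)"
      using i unfolding v_def by (intro sum.cong refl arg_cong2[where f = "(*)"] X_last_column) auto
    ultimately show ?thesis by (simp add: X_last_column[OF i] v_def v'_def)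
  qed
  have low: "v' i = v i" if "i \<in> {1..<n}" "n \<le> 2 * i" for i
  proof -
    have "{i+1..n-i} = {}" using that by auto
    then show ?thesis using col[OF that(1)] by (simp only: sum.empty add_0_right)
  qed
  have mem: "(m, n - m) \<in> S \<longleftrightarrow> (m, n - m) \<in> S'" "(m, n - m) \<in> S \<Longrightarrow> b m = b' m"
    if m: "m \<in> {1..k}" for m
  proof -
    have "n - m \<in> {1..<n}" "n \<le> 2 * (n - m)" using m n_bounds by auto
    then have "v' (n - m) = v (n - m)" by (rule low)
    then have "(if (m, n - m) \<in> S' then b' m else 0) = (if (m, n - m) \<in> S then b m else 0)"
      unfolding v_def v'_def X_last_low[OF m] .
    moreover have "(m, n - m) \<in> S \<Longrightarrow> b m \<noteq> 0" "(m, n - m) \<in> S' \<Longrightarrow> b' m \<noteq> 0"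
      using b by (auto simp: Lambda_set_def)
    ultimately show "(m, n - m) \<in> S \<longleftrightarrow> (m, n - m) \<in> S'" "(m, n - m) \<in> S \<Longrightarrow> b m = b' m"
      by (auto split: if_splits)
  qed
  have SS': "S = S'"
  proof -
    have "p \<in> S \<longleftrightarrow> p \<in> S'" if p: "p \<in> Pi_set n" for p
    proof -
      obtain m where "p = (m, n - m)" "m \<in> {1..k}" using p by (auto simp: Pi_set_def)
      then show ?thesis using mem(1) by simp
    qed
    then show ?thesis using S by blast
  qed
  have bb': "b i = b' i" if i: "i \<in> {1..k + eps n}" for i
  proof (cases "i \<le> k")
    case False
    \<comment> \<open>This happens for even \<open>n\<close> only, with i = k + 1 = n / 2.\<close>
    then have "n \<le> 2 * i" "i \<in> {1..<n}" using i n_eps by (auto simp: eps_def split: if_splits)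
    then show ?thesis using low[of i] i by (auto simp: v_def v'_def X_last_def)
  next
    case True
    then have ik: "i \<in> {1..k}" using i by simp
    show ?thesis
    proof (cases "(i, n - i) \<in> S")
      case True
      then show ?thesis using mem(2)[OF ik] by simp
    next
      case False
      have scaled: "b i * v' r = b' i * v' r" if r: "r \<in> {i<..<n-i}" for r
      proof -
        have "r \<in> {1..<n}" using r by auto
        note rn = X_last_column[OF this]
        show ?thesis
          using proportional_double_coset[OF X_G_minus X_G_minus h eq X_proportional X_proportional ik r]
            False SS' by (simp add: v'_def rn)
      qed
      show ?thesis
      proof (cases "\<exists>r\<in>{i<..<n-i}. v' r \<noteq> 0")
        case True
        then obtain r where "r \<in> {i<..<n-i}" "v' r \<noteq> 0" by blast
        then show ?thesis using scaled[of r] by simp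
      next
        case v': False
        \<comment> \<open>The relations \<open>col\<close> are unitriangular, so the zeros of
          \<open>v'\<close> pass to \<open>v\<close>, starting from the bottom row.\<close>
        have v0: "v r = 0" if "r \<in> {i<..<n-i}" for r
          using that
        proof (induction "n - r" arbitrary: r rule: less_induct)
          case less
          have "(\<Sum>s\<in>{r+1..n-r}. ent h r s * v s) = 0"
            using less by (intro sum.neutral) auto
          then show ?case using col[of r] v' less.prems by auto
        qed
        have "v (n - i) = 0"
          using False by (simp add: v_def X_last_low[OF ik])
        then have "v r = 0" if "r \<in> {i+1..n-i}" for r
          using v0[of r] that by (cases "r = n - i") auto
        then have "v' i = v i" using col[of i] ik n_bounds by auto
        then show ?thesis using i by (simp add: v_def v'_def X_last_def)
      qed
    qed
  qed
  have "b = b'"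
  proof (rule PiE_ext)
    show "b \<in> {1..k + eps n} \<rightarrow>\<^sub>E UNIV" "b' \<in> {1..k + eps n} \<rightarrow>\<^sub>E UNIV"
      using b by (auto simp: Lambda_set_def)
  qed (rule bb')
  moreover have "lam (h - 1\<^sub>m n) = lam (h' - 1\<^sub>m n)"
    by (rule lam_double_coset[OF X_G_minus X_G_minus h eq X_proportional]) (simp add: SS' \<open>b = b'\<close>)
  ultimately show ?thesis using SS' by simp
qed

text \<open>For \<open>m = 1, 2, \<dots>\<close> in turn, each row vector \<open>a\<close> with support in the columns
  \<open>m + 1, \<dots>, n - m\<close> that kills the last column of \<open>y\<close> gives a pair
  \<open>1 + e\<^sub>m a\<close>, \<open>1 + e\<^sub>m a y\<close> in the stabilizer of \<open>y\<close>. That the characters agree on it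
  forces \<open>a\<close> to kill the column \<open>n - m\<close> of \<open>y - 1\<close> as well.\<close>

lemma admissible_proportional:
  assumes y: "y \<in> G_minus" and adm: "admissible y"
  shows "\<exists>t. proportional t y"
proof -
  have "\<exists>c. (\<forall>r\<in>{m<..<n-m}. ent y r (n - m) = c * ent y r n) \<and> c * ent y (n - m) n = 0"
    if "m \<in> {1..k}" for m
    using that
  proof (induction m rule: less_induct)
    case (less m)
    note m = less.prems
    show ?case
    proof (cases "n - m \<le> m + 1")
      case True
      \<comment> \<open>Here n is odd and m = k, and (m, n - m) is the root common to Pi and Pi_0,
        on which nondegeneracy is silent. No row lies strictly between m and n - m, so c = 0
        works.\<close>
      then have "{m<..<n-m} = {}" by auto
      then show ?thesis by (intro exI[of _ 0]) simp
    next
      case False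
      define R where "R = {m+1..n-m}"
      define lm where "lm = lam (E_mat n (m, n - m))"
      \<comment> \<open>This is column n - m of y - 1. The value 0 in row n - m encodes the
        condition \<open>c * ent y (n - m) n = 0\<close> in the same proportionality.\<close>
      define w where "w r = (if r < n - m then ent y r (n - m) else 0)" for r
      have rng: "m \<in> {1..n}" "m + 1 \<in> {1..n}" "n - m \<in> {1..n}" "n \<in> {1..n}"
        using m n_bounds by auto
      have R: "finite R" "R \<subseteq> {1..n}" "m \<notin> R" "m + 1 \<in> R" "n - m \<in> R"
        using m n_bounds by (auto simp: R_def)
      have lm: "lm \<noteq> 0"
        using nondeg m False unfolding nondegenerate_def lm_def
        by (auto simp: Pi_set_def Pi0_set_def)
      have E: "E_mat n (m, n - m) \<in> g_plus n"
      proof -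
        have "E_mat n (m, n - m) \<in> carrier_mat n n" by (simp add: E_mat_def)
        then show ?thesis using m n_bounds by (auto simp: g_plus_ent)
      qed
      have psi_one: "\<psi> ((\<Sum>r\<in>R. a r * w r) * lm) = 1" if a: "(\<Sum>r\<in>R. a r * ent y r n) = 0" for a
      proof -
        define d where "d = (\<Sum>r\<in>R. a r * w r)"
        define ay where "ay j = (\<Sum>r\<in>R. a r * ent y r j)" for j
        define fh where "fh i j = (if i = j then 1 else if i = m \<and> j \<in> R then a j else 0)" for i j
        define fh' where "fh' i j = (if i = j then 1 else if i = m \<and> j \<in> R then ay j else 0)" for i j
        define h where "h = mat n n (\<lambda>(i, j). fh (i + 1) (j + 1))"
        define h' where "h' = mat n n (\<lambda>(i, j). fh' (i + 1) (j + 1))"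
        have ent_h: "ent h i j = fh i j" and ent_h': "ent h' i j = fh' i j"
          if "i \<in> {1..n}" "j \<in> {1..n}" for i j
          unfolding h_def h'_def by (rule ent_mat[OF that])+
        have carrier: "h \<in> carrier_mat n n" "h' \<in> carrier_mat n n" by (auto simp: h_def h'_def)
        have G: "h \<in> G_plus n" "h' \<in> G_plus n"
          using carrier m n_bounds
          by (auto simp: G_plus_ent ent_h ent_h' fh_def fh'_def R_def)
        \<comment> \<open>This makes 1 + e_m a y an element of H. Columns up to m vanish by
          triangularity, column n by the choice of a, and a column n - m' with m' < m is a multiple
          of the last one on the rows in \<open>R\<close>.\<close>
        have ay_zero: "ay j = 0" if j: "j \<in> {1..n}" "j \<notin> R" for j
        proof -
          consider "j \<le> m" | "j = n" | "n - m < j" "j < n" using j by (force simp: R_def)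
          then show ?thesis
          proof cases
            case 1
            then have "ent y r j = 0" if "r \<in> R" for r
              using that ent_G_minus(1)[OF y _ j(1), of r] R by (auto simp: R_def)
            then show ?thesis by (simp add: ay_def)
          next
            case 2
            then show ?thesis using a by (simp add: ay_def)
          next
            case 3
            define m' where "m' = n - j"
            have m': "m' < m" "m' \<in> {1..k}" "n - m' = j" using 3 m by (auto simp: m'_def)
            obtain c where c: "\<And>r. r \<in> {m'<..<n-m'} \<Longrightarrow> ent y r (n - m') = c * ent y r n"
              using less.IH[OF m'(1,2)] by blast
            have "ay j = (\<Sum>r\<in>R. a r * (c * ent y r n))"
              unfolding ay_def using c m' 3
              by (intro sum.cong refl arg_cong2[where f = "(*)"]) (auto simp: R_def)
            also have "\<dots> = c * (\<Sum>r\<in>R. a r * ent y r n)"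
              by (simp add: sum_distrib_left mult_ac)
            finally show ?thesis using a by simp
          qed
        qed
        have "h * y = y * h'"
        proof (rule eq_mat_entI[of _ n])
          fix i j assume ij: "i \<in> {1..n}" "j \<in> {1..n}"
          have "(\<Sum>r\<in>{i+1..n-i}. ent h i r * ent y r j) = (if i = m then ay j else 0)"
          proof (cases "i = m")
            case True
            have "ent h m r = a r" if "r \<in> R" for r
              using that R rng by (auto simp: ent_h fh_def subset_iff)
            then show ?thesis unfolding True ay_def R_def by simp
          next
            case False
            then show ?thesis using ij
              by (auto simp: ent_h fh_def intro!: sum.neutral)
          qed
          then have "ent (h * y) i j = ent y i j + (if i = m then ay j else 0)"
            using ent_G_plus_mult[OF G(1) G_minus_carrier[OF y] ij] by simp
          also have "\<dots> = (if i < j \<and> i + j \<le> n then fh' i j else ent y i j)"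
          proof (cases "i < j \<and> i + j \<le> n")
            case True
            then have "i = m \<Longrightarrow> j \<in> R" by (auto simp: R_def)
            then show ?thesis using True ent_G_minus(3)[OF y ij] by (auto simp: fh'_def)
          next
            case False
            then have "i = m \<Longrightarrow> j \<notin> R" by (auto simp: R_def)
            then have "i = m \<Longrightarrow> ay j = 0" using ay_zero[OF ij(2)] by simp
            then show ?thesis using False by auto
          qed
          finally show "ent (h * y) i j = ent (y * h') i j"
            by (simp only: ent_G_minus_mult[OF y G(2) ij] ent_h'[OF ij])
        qed (rule mult_carrier_mat carrier G_minus_carrier[OF y])+
        then have xi_eq: "\<psi> (lam (h - 1\<^sub>m n)) = \<psi> (lam (h' - 1\<^sub>m n))"
          using adm G by (auto simp: admissible_def xi_char_def)
        \<comment> \<open>Of the entries that a character sees, a y and a differ only in column n -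
          m. The diagonal of y reproduces a there, and the rest of the column adds
          \<open>d\<close>.\<close>
        have "lam (h' - 1\<^sub>m n) = lam ((h - 1\<^sub>m n) + d \<cdot>\<^sub>m E_mat n (m, n - m))"
        proof (rule lam_cong)
          fix i assume i: "i \<in> {1..k}"
          have irng: "i \<in> {1..n}" "i + 1 \<in> {1..n}" "n - i \<in> {1..n}" "i \<noteq> n - i"
            using i n_bounds by auto
          have "ay (m + 1) = (\<Sum>r\<in>R. if r = m + 1 then a (m + 1) else 0)"
            unfolding ay_def using R ent_G_minus[OF y _ rng(2)]
            by (intro sum.cong) (auto simp: R_def)
          then have ay1: "ay (m + 1) = a (m + 1)" using R by simp
          have "ay (n - m) = (\<Sum>r\<in>R. a r * w r + (if r = n - m then a (n - m) else 0))"
            unfolding ay_def using ent_G_minus(2)[OF y rng(3) rng(3)]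
            by (intro sum.cong) (auto simp: R_def w_def)
          then have ay2: "ay (n - m) = a (n - m) + d" using R by (simp add: sum.distrib d_def)
          have "fh' i (i + 1) = fh i (i + 1)"
            using ay1 by (auto simp: fh_def fh'_def)
          moreover have "fh' i (n - i) = fh i (n - i) + d * (if i = m then 1 else 0)"
            using ay2 R irng(4) by (auto simp: fh_def fh'_def)
          moreover have "(i, i + 1) \<noteq> (m, n - m)" "(i, n - i) = (m, n - m) \<longleftrightarrow> i = m"
            using False by auto
          moreover have "ent (h' - 1\<^sub>m n) i j = fh' i j - (if i = j then 1 else 0)"
            "ent ((h - 1\<^sub>m n) + d \<cdot>\<^sub>m E_mat n (m, n - m)) i j
              = fh i j - (if i = j then 1 else 0) + d * (if (i, j) = (m, n - m) then 1 else 0)"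
            if j: "j \<in> {1..n}" for j
            using irng(1) j
            by (simp_all add: ent_h ent_h' ent_minus[OF _ one_carrier_mat] carrier
                ent_add[OF minus_carrier_mat[OF one_carrier_mat]
                  smult_carrier_mat[OF g_plus_carrier[OF E]]]
                ent_smult[OF g_plus_carrier[OF E]])
          ultimately show "ent (h' - 1\<^sub>m n) i (i + 1)
              = ent ((h - 1\<^sub>m n) + d \<cdot>\<^sub>m E_mat n (m, n - m)) i (i + 1) \<and>
            ent (h' - 1\<^sub>m n) i (n - i)
              = ent ((h - 1\<^sub>m n) + d \<cdot>\<^sub>m E_mat n (m, n - m)) i (n - i)"
            using irng by (simp del: prod.inject)
        qed (intro g_plus_add_closed g_plus_smult_closed G_plus_minus_one G E)+
        also have "\<dots> = lam (h - 1\<^sub>m n) + d * lm"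
          using lam_add[OF G_plus_minus_one[OF G(1)] g_plus_smult_closed[OF E]] lam_smult[OF E]
          by (simp add: lm_def)
        finally have "\<psi> (lam (h - 1\<^sub>m n)) = \<psi> (lam (h - 1\<^sub>m n)) * \<psi> (d * lm)"
          using xi_eq by (simp add: psi_add)
        then show ?thesis using psi_nonzero by (simp add: d_def)
      qed
      have "\<exists>c. \<forall>r\<in>R. w r = c * ent y r n"
      proof (rule functional_vanishing_on_kernel[OF R(1)], rule ccontr)
        fix a assume a: "(\<Sum>r\<in>R. a r * ent y r n) = 0" and d: "(\<Sum>r\<in>R. a r * w r) \<noteq> 0"
        obtain x where x: "\<psi> x \<noteq> 1" using psi by (auto simp: nontrivial_additive_character_def)
        \<comment> \<open>The admissible vectors a form a subspace, so rescaling brings the argument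
          of \<open>\<psi>\<close> to a point where \<open>\<psi>\<close> is not 1.\<close>
        define c where "c = x / ((\<Sum>r\<in>R. a r * w r) * lm)"
        have scale: "(\<Sum>r\<in>R. (c * a r) * u r) = c * (\<Sum>r\<in>R. a r * u r)" for u
          by (simp add: sum_distrib_left mult.assoc)
        have "\<psi> (c * (\<Sum>r\<in>R. a r * w r) * lm) = 1"
          using psi_one[of "\<lambda>r. c * a r"] a unfolding scale by simp
        then show False using x d lm by (simp add: c_def)
      qed
      then obtain c where c: "\<And>r. r \<in> R \<Longrightarrow> w r = c * ent y r n" by blast
      have "ent y r (n - m) = c * ent y r n" if "r \<in> {m<..<n-m}" for r
        using c[of r] that by (auto simp: R_def w_def)
      moreover have "c * ent y (n - m) n = 0"
        using c[of "n - m"] R by (simp add: w_def)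
      ultimately show ?thesis by blast
    qed
  qed
  then obtain t where "\<And>m. m \<in> {1..k} \<Longrightarrow>
      (\<forall>r\<in>{m<..<n-m}. ent y r (n - m) = t m * ent y r n) \<and> t m * ent y (n - m) n = 0"
    by metis
  then show ?thesis unfolding proportional_def by blast
qed

lemma X_cover:
  assumes g: "g \<in> carrier (UT n)" "admissible g"
  shows "\<exists>(S, b)\<in>X_index n. \<exists>h\<in>G_plus n. \<exists>h'\<in>G_plus n. h * g = X_mat n S b * h'"
proof -
  obtain y h0 where y: "y \<in> G_minus" and h0: "h0 \<in> G_plus n" and g_eq: "g = y * h0"
    using UT_factorization[OF g(1)] by blast
  have "1\<^sub>m n * g = y * h0" using left_mult_one_mat[OF UT_carrier[OF g(1)]] g_eq by simp
  then have adm_y: "admissible y"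
    using admissible_double_coset[OF g(2,1) G_minus_UT[OF y], of "1\<^sub>m n" h0] h0 by simp
  obtain t where t: "proportional t y" using admissible_proportional[OF y adm_y] by blast
  define v where "v i = ent y i n" for i
  define S where "S = {(m, n - m) | m. m \<in> {1..k} \<and> v (n - m) \<noteq> 0}"
  define b where "b = (\<lambda>i\<in>{1..k + eps n}.
    if i \<in> {1..k} \<and> v (n - i) \<noteq> 0 then v (n - i)
    else if i \<in> {1..k} \<and> (\<exists>r\<in>{i<..<n-i}. v r \<noteq> 0) then t i else v i)"
  have S_iff: "(m, n - m) \<in> S \<longleftrightarrow> v (n - m) \<noteq> 0" if "m \<in> {1..k}" for m
    using that by (auto simp: S_def)
  have index: "(S, b) \<in> X_index n"
  proof -
    have "S \<subseteq> Pi_set n" by (auto simp: S_def Pi_set_def)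
    moreover have "b i \<noteq> 0" if "(i, n - i) \<in> S" for i
      using that by (auto simp: S_def b_def)
    moreover have "b \<in> {1..k + eps n} \<rightarrow>\<^sub>E UNIV" by (auto simp: b_def)
    ultimately show ?thesis by (auto simp: X_index_def Lambda_set_def)
  qed
  \<comment> \<open>Here \<open>a\<close> is the row i of the matrix \<open>h\<close> to be built.
    For i \<le> k a pivot \<open>v r \<noteq> 0\<close> lets one entry reach any target; in all
    other cases the target already equals \<open>v i\<close>.\<close>
  have "\<exists>a. (\<Sum>r\<in>{i+1..n-i}. a r * v r) = X_last n S b i - v i" if i: "i \<in> {1..<n}" for i
  proof (cases "i \<in> {1..k} \<and> (\<exists>r\<in>{i+1..n-i}. v r \<noteq> 0)")
    case True
    then obtain r where r: "r \<in> {i+1..n-i}" "v r \<noteq> 0" by auto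
    have "(\<Sum>s\<in>{i+1..n-i}. (if s = r then (X_last n S b i - v i) / v r else 0) * v s)
        = (\<Sum>s\<in>{i+1..n-i}. if s = r then X_last n S b i - v i else 0)"
      using r by (intro sum.cong) auto
    also have "\<dots> = X_last n S b i - v i" using r(1) by (simp only: sum.delta finite_atLeastAtMost if_True)
    finally show ?thesis by (rule exI[of "\<lambda>a. (\<Sum>s\<in>{i+1..n-i}. a s * v s) = _"])
  next
    case no_pivot: False
    have "X_last n S b i = v i"
    proof (cases "i \<le> k + eps n")
      case True
      then have "i \<in> {1..k} \<Longrightarrow> v (n - i) = 0 \<and> (\<forall>r\<in>{i<..<n-i}. v r = 0)"
        using no_pivot n_bounds by auto
      then show ?thesis using True i by (auto simp: X_last_def b_def)
    next
      case False
      define m where "m = n - i"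
      have m: "m \<in> {1..k}" "n - m = i" using False i n_eps by (auto simp: m_def)
      then have "v (n - m) \<noteq> 0 \<Longrightarrow> b m = v (n - m)" by (auto simp: b_def)
      then have "X_last n S b (n - m) = v (n - m)"
        by (auto simp: X_last_low[OF m(1)] S_iff[OF m(1)])
      then show ?thesis unfolding m(2) .
    qed
    then show ?thesis by (intro exI[of _ "\<lambda>_. 0"]) simp
  qed
  then obtain a where a: "\<And>i. i \<in> {1..<n} \<Longrightarrow>
      (\<Sum>r\<in>{i+1..n-i}. a i r * v r) = X_last n S b i - v i"
    by metis
  define fh where "fh i j = (if i = j then 1 else if i < j \<and> i + j \<le> n then a i j else 0)" for i j
  define h where "h = mat n n (\<lambda>(i, j). fh (i + 1) (j + 1))"
  have ent_h: "ent h i j = fh i j" if "i \<in> {1..n}" "j \<in> {1..n}" for i j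
    unfolding h_def by (rule ent_mat[OF that])
  have "h \<in> carrier_mat n n" by (simp add: h_def)
  then have h: "h \<in> G_plus n" by (auto simp: G_plus_ent ent_h fh_def)
  obtain y' h' where y': "y' \<in> G_minus" and h': "h' \<in> G_plus n" and eq: "h * y = y' * h'"
    using UT_factorization[OF UT_mult_closed[OF G_plus_UT[OF h] G_minus_UT[OF y]]] by blast
  \<comment> \<open>Proportionality of \<open>y'\<close> is obtained afresh from admissibility, not
    computed from that of \<open>y\<close>. Its factors agree with \<open>t\<close> after
    multiplication by entries of the last column of \<open>y'\<close>, and they are only used in
    such products.\<close>
  have "admissible y'"
    using admissible_double_coset[OF adm_y G_minus_UT[OF y] G_minus_UT[OF y'] h h'] eq by simp
  then obtain t' where t': "proportional t' y'" using admissible_proportional[OF y'] by blast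
  have last: "ent y' i n = v i + (\<Sum>r\<in>{i+1..n-i}. ent h i r * v r)" if "i \<in> {1..n}" for i
    using last_column[OF y y' h h' eq that] by (simp add: v_def)
  have col: "ent y' i n = X_last n S b i" if i: "i \<in> {1..<n}" for i
  proof -
    have "i \<in> {1..n}" using i by simp
    moreover have "(\<Sum>r\<in>{i+1..n-i}. ent h i r * v r) = (\<Sum>r\<in>{i+1..n-i}. a i r * v r)"
      using i by (intro sum.cong) (auto simp: ent_h fh_def split: if_splits)
    ultimately show ?thesis using a[OF i] last[of i] by simp
  qed
  have middle: "ent y' i (n - m) = X_entry n S b i (n - m)"
    if m: "m \<in> {1..k}" and i: "i \<in> {m<..<n-m}" for m i
  proof -
    have mi: "n - m \<noteq> n" "n - (n - m) = m" "i \<in> {1..<n}" "\<not> i + (n - m) < n + 1" "i < n - m"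
      "m \<in> {1..k + eps n}" "X_last n S b m = b m"
      using m i n_bounds by (auto simp: X_last_def)
    have "ent y' i (n - m) = t' m * ent y' i n"
      using t' m i by (auto simp: proportional_def)
    also have "\<dots> = t m * ent y' i n"
      by (rule proportional_double_coset[OF y y' h h' eq t t' m i, symmetric])
    also have "\<dots> = (if (m, n - m) \<in> S then 0 else b m * ent y' i n)"
    proof (cases "v (n - m) = 0")
      case False
      then have "t m = 0" using t m by (auto simp: proportional_def v_def)
      then show ?thesis using False S_iff[OF m] by simp
    next
      case v0: True
      show ?thesis
      proof (cases "\<exists>r\<in>{m<..<n-m}. v r \<noteq> 0")
        case True
        then have "b m = t m" using v0 m mi(6) by (simp add: b_def)
        then show ?thesis using v0 S_iff[OF m] by simp
      next
        case False
        \<comment> \<open>All rows involved lie strictly between m and n - m, so the last column of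
          \<open>y'\<close> vanishes in row i as well. Thus it does no harm that \<open>b m\<close>
          is now \<open>v m\<close> and unrelated to \<open>t m\<close>.\<close>
        then have "v i = 0" "(\<Sum>r\<in>{i+1..n-i}. ent h i r * v r) = 0"
          using i by (auto intro!: sum.neutral)
        then have "ent y' i n = 0" using last[of i] mi(3) by simp
        then show ?thesis by simp
      qed
    qed
    also have "\<dots> = X_entry n S b i (n - m)"
      using mi by (simp add: X_entry_def col)
    finally show ?thesis .
  qed
  have "y' = X_mat n S b"
  proof (rule eq_mat_entI[of _ n])
    fix i j assume ij: "i \<in> {1..n}" "j \<in> {1..n}"
    consider "j \<le> i" | "i < j" "i + j \<le> n" | "i < j" "j = n" | "i < j" "n < i + j" "j < n"
      using ij by force
    then have "ent y' i j = X_entry n S b i j"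
    proof cases
      case 1
      then show ?thesis using ent_G_minus[OF y' ij] ij by (cases "i = j") (auto simp: X_entry_def ent_G_minus(2)[OF y'])
    next
      case 2
      then show ?thesis using ent_G_minus[OF y' ij] by (auto simp: X_entry_def)
    next
      case 3
      then have "i \<in> {1..<n}" using ij by simp
      then show ?thesis using 3 by (simp add: col X_entry_def)
    next
      case 4
      define m where "m = n - j"
      have "m \<in> {1..k}" "i \<in> {m<..<n-m}" "n - m = j" using 4 n_bounds by (auto simp: m_def)
      then show ?thesis using middle[of m i] by simp
    qed
    then show "ent y' i j = ent (X_mat n S b) i j" by (simp only: ent_X[OF ij])
  qed (use y' X_G_minus G_minus_carrier in auto)
  then have "h * y * h0 = X_mat n S b * h' * h0" using eq by simp
  then have "h * g = X_mat n S b * (h' * h0)"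
    unfolding g_eq
    using assoc_mult_mat[OF G_plus_carrier[OF h] G_minus_carrier[OF y] G_plus_carrier[OF h0]]
      assoc_mult_mat[OF G_minus_carrier[OF X_G_minus] G_plus_carrier[OF h'] G_plus_carrier[OF h0], of S b]
    by simp
  then show ?thesis using index h G_plus_mult_closed[OF h' h0] by blast
qed

lemma finite_X_index: "finite (X_index n :: ((nat \<times> nat) set \<times> (nat \<Rightarrow> 'a)) set)"
proof -
  have "Pi_set n = (\<lambda>i. (i, n - i)) ` {1..k}" by (auto simp: Pi_set_def)
  then have "finite (Pow (Pi_set n) \<times> ({1..k + eps n} \<rightarrow>\<^sub>E (UNIV :: 'a set)))"
    by (intro finite_cartesian_product finite_PiE) auto
  then show ?thesis
    by (rule rev_finite_subset) (auto simp: X_index_def Lambda_set_def)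
qed

lemma PXP_basis:
  "basis_family fscale (X_index n) (PXP n (xi_char n \<psi> lam))
    (sandwich_space (UT n) (G_plus n) (xi_char n \<psi> lam))"
proof -
  have "basis_family fscale (X_index n)
    (\<lambda>p. sandwich (UT n) (G_plus n) (xi_char n \<psi> lam) (group_elt (X_mat n (fst p) (snd p))))
    (sandwich_space (UT n) (G_plus n) (xi_char n \<psi> lam))"
  proof (rule sandwich_basis[OF finite_X_index])
    show "X_mat n (fst p) (snd p) \<in> carrier (UT n)" for p :: "(nat \<times> nat) set \<times> (nat \<Rightarrow> 'a)"
      by (rule G_minus_UT[OF X_G_minus])
    show "\<exists>p\<in>X_index n. \<exists>h\<in>G_plus n. \<exists>h'\<in>G_plus n.
        h \<otimes>\<^bsub>UT n\<^esub> g = X_mat n (fst p) (snd p) \<otimes>\<^bsub>UT n\<^esub> h'"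
      if "g \<in> carrier (UT n)" "admissible g" for g
      using X_cover[OF that] by (simp add: case_prod_beta)
    show "p = q \<and> xi_char n \<psi> lam h = xi_char n \<psi> lam h'"
      if "p \<in> X_index n" "q \<in> X_index n" "h \<in> G_plus n" "h' \<in> G_plus n"
        "h \<otimes>\<^bsub>UT n\<^esub> X_mat n (fst p) (snd p) = X_mat n (fst q) (snd q) \<otimes>\<^bsub>UT n\<^esub> h'" for p q h h'
      using that X_separate[of "fst p" "snd p" "fst q" "snd q" h h']
      by (auto simp: xi_char_def prod_eq_iff)
  qed
  then show ?thesis by (simp add: PXP_def case_prod_beta')
qed

end

theorem theorem5p2:
  fixes n :: nat
    and lam :: "'a::{field, finite} mat \<Rightarrow> 'a"
    and \<psi> :: "'a \<Rightarrow> complex"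
    and \<xi> :: "'a mat \<Rightarrow> complex"
  assumes "n > 2"
    and "nontrivial_additive_character \<psi>"
    and "algebra_character n lam"
    and "nondegenerate n lam"
    and "\<xi> = xi_char n \<psi> lam"
  shows "basis_family fscale (X_index n) (PXP n \<xi>) (sandwich_space (UT n) (G_plus n) \<xi>)
    \<and> basis_family oscale (X_index n) (\<lambda>p. right_mult (UT n) (G_plus n) \<xi> (PXP n \<xi> p))
        (hecke_algebra (UT n) (G_plus n) \<xi>)"
proof -
  interpret algebra_char n lam \<psi> using assms(1-4) by unfold_locales
  show ?thesis unfolding assms(5) using PXP_basis hecke_basis by blast
qed

end
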